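(* Let $\Gamma$ be a finite simplicial graph that is biconnected, and let $d=\operatorname{diam}(\bar\Gamma)$ be the diameter of its complement graph. If $d\ge 3$, then, for the action of the right-angled Artin group $A(\Gamma)$ on its extension graph $(\Gamma^e,d_e)$, the minimal asymptotic translation length satisfies $$\mathcal L_{(\Gamma^e,d_e)}(A(\Gamma))\le \frac{2}{d-2}.$$
   Context: Graphs are simplicial (no loops, no multiple edges). For a graph $\Gamma$, $V(\Gamma)$ and $E(\Gamma)$ are the vertex and edge sets, and $\bar\Gamma$ is the complement graph (same vertices; two distinct vertices are adjacent in $\bar\Gamma$ iff they are not adjacent in $\Gamma$). $\Gamma$ is biconnected if both $\Gamma$ and $\bar\Gamma$ are connected. The diameter $\operatorname{diam}$ of a graph is the maximum over pairs of vertices of the graph distance (length of a shortest path). The right-angled Artin group on a finite simplicial graph $\Gamma$ is $A(\Gamma)=\langle v\in V(\Gamma) : v_iv_j=v_jv_i \text{ if } \{v_i,v_j\}\in E(\Gamma)\rangle$. Write $v^g=g^{-1}vg$. The extension graph $\Gamma^e$ has vertex set $V(\Gamma^e)=\{v^g : v\in V(\Gamma), g\in A(\Gamma)\}\subset A(\Gamma)$, and two distinct vertices $v_1^{g_1},v_2^{g_2}$ are adjacent iff they commute in $A(\Gamma)$. $d_e$ denotes the graph metric on $\Gamma^e$ (length of a shortest path); $\Gamma^e$ is connected when $\Gamma$ is biconnected with at least two vertices. $A(\Gamma)$ acts on $\Gamma^e$ from the right by conjugation, $x\cdot g=g^{-1}xg$ for $x\in V(\Gamma^e)$, by isometries. For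 a group $G$ acting by isometries from the right on a connected metric space $(X,d_X)$ and $g\in G$, the asymptotic translation length is $\tau_{(X,d_X)}(g)=\lim_{n\to\infty} d_X(xg^n,x)/n$ for $x\in X$ (the limit exists and is independent of $x$). The minimal asymptotic translation length is $\mathcal L_{(X,d_X)}(G)=\min\{\tau_{(X,d_X)}(g): g\in G,\ \tau_{(X,d_X)}(g)>0\}$. *)

theory Defs
  imports "HOL-Analysis.Analysis" "HOL-Algebra.Group"
begin

section \<open>Simplicial graphs\<close>

text \<open>
  A simplicial graph is a vertex set together with a symmetric irreflexive adjacency
  relation on it; an unordered edge is represented by its two orientations.
\<close>

definition simplicial_graph :: "'a set \<Rightarrow> ('a \<times> 'a) set \<Rightarrow> bool" where
  "simplicial_graph V E \<longleftrightarrow> E \<subseteq> V \<times> V \<and> sym E \<and> irrefl E"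

definition complement_edges :: "'a set \<Rightarrow> ('a \<times> 'a) set \<Rightarrow> ('a \<times> 'a) set" where
  "complement_edges V E = {(u, v). u \<in> V \<and> v \<in> V \<and> u \<noteq> v \<and> (u, v) \<notin> E}"

definition graph_connected :: "'a set \<Rightarrow> ('a \<times> 'a) set \<Rightarrow> bool" where
  "graph_connected V E \<longleftrightarrow> (\<forall>u\<in>V. \<forall>v\<in>V. (u, v) \<in> E\<^sup>*)"

definition biconnected :: "'a set \<Rightarrow> ('a \<times> 'a) set \<Rightarrow> bool" where
  "biconnected V E \<longleftrightarrow> graph_connected V E \<and> graph_connected V (complement_edges V E)"

text \<open>
  \<^term>\<open>E ^^ n\<close> relates the endpoints of walks of length \<open>n\<close>. The value is meaningful only
  for vertices in the same component.
\<close>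

definition graph_dist :: "('a \<times> 'a) set \<Rightarrow> 'a \<Rightarrow> 'a \<Rightarrow> nat" where
  "graph_dist E u v = (LEAST n. (u, v) \<in> E ^^ n)"

text \<open>For finite connected graphs; on \<^typ>\<open>nat\<close> the supremum of a finite set is its maximum, and
  \<open>0\<close> for the empty set.\<close>

definition graph_diam :: "'a set \<Rightarrow> ('a \<times> 'a) set \<Rightarrow> nat" where
  "graph_diam V E = Sup {graph_dist E u v | u v. u \<in> V \<and> v \<in> V}"


section \<open>Right-angled Artin groups\<close>

text \<open>
  The group given by the presentation is the set of words in the letters \<open>v\<close> and
  \<open>v\<inverse>\<close>, encoded as \<open>(v, True)\<close> and \<open>(v, False)\<close>, modulo the least congruence that makes
  the two letters mutually inverse and contains the defining relations.
\<close>

definition raag_words :: "'a set \<Rightarrow> ('a \<times> bool) list set" where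
  "raag_words V = lists (V \<times> UNIV)"

inductive_set raag_cong ::
    "'a set \<Rightarrow> ('a \<times> 'a) set \<Rightarrow> (('a \<times> bool) list \<times> ('a \<times> bool) list) set"
  for V :: "'a set" and E :: "('a \<times> 'a) set" where
  refl: "w \<in> raag_words V \<Longrightarrow> (w, w) \<in> raag_cong V E"
| sym: "(u, w) \<in> raag_cong V E \<Longrightarrow> (w, u) \<in> raag_cong V E"
| trans: "(u, v) \<in> raag_cong V E \<Longrightarrow> (v, w) \<in> raag_cong V E \<Longrightarrow> (u, w) \<in> raag_cong V E"
| append: "(u, u') \<in> raag_cong V E \<Longrightarrow> (w, w') \<in> raag_cong V E
    \<Longrightarrow> (u @ w, u' @ w') \<in> raag_cong V E"
| cancel: "v \<in> V \<Longrightarrow> ([(v, b), (v, \<not> b)], []) \<in> raag_cong V E"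
| commute: "u \<in> V \<Longrightarrow> v \<in> V \<Longrightarrow> (u, v) \<in> E
    \<Longrightarrow> ([(u, True), (v, True)], [(v, True), (u, True)]) \<in> raag_cong V E"

definition raag :: "'a set \<Rightarrow> ('a \<times> 'a) set \<Rightarrow> ('a \<times> bool) list set monoid" where
  "raag V E =
    \<lparr>carrier = raag_words V // raag_cong V E,
     mult = (\<lambda>A B. \<Union>a\<in>A. \<Union>b\<in>B. raag_cong V E `` {a @ b}),
     one = raag_cong V E `` {[]}\<rparr>"

definition raag_gen :: "'a set \<Rightarrow> ('a \<times> 'a) set \<Rightarrow> 'a \<Rightarrow> ('a \<times> bool) list set" where
  "raag_gen V E v = raag_cong V E `` {[(v, True)]}"

lemma raag_cong_words:
  "(u, w) \<in> raag_cong V E \<Longrightarrow> u \<in> raag_words V \<and> w \<in> raag_words V"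
  by (induction rule: raag_cong.induct) (auto simp: raag_words_def)

lemma equiv_raag_cong: "equiv (raag_words V) (raag_cong V E)"
proof (rule equivI)
  show "raag_cong V E \<subseteq> raag_words V \<times> raag_words V"
    by (auto dest: raag_cong_words)
  show "refl_on (raag_words V) (raag_cong V E)"
    by (rule refl_onI) (rule raag_cong.refl)
  show "Relation.sym (raag_cong V E)"
    by (rule symI) (rule raag_cong.sym)
  show "Relation.trans (raag_cong V E)"
    by (rule transI) (rule raag_cong.trans)
qed

lemma raag_mult_class:
  assumes "u \<in> raag_words V" "w \<in> raag_words V"
  shows "(raag_cong V E `` {u}) \<otimes>\<^bsub>raag V E\<^esub> (raag_cong V E `` {w}) = raag_cong V E `` {u @ w}"
proof -
  have "raag_cong V E `` {a @ b} = raag_cong V E `` {u @ w}"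
    if "(u, a) \<in> raag_cong V E" "(w, b) \<in> raag_cong V E" for a b
    using equiv_class_eq[OF equiv_raag_cong raag_cong.append[OF that]] by simp
  then have "(\<Union>a\<in>raag_cong V E `` {u}. \<Union>b\<in>raag_cong V E `` {w}. raag_cong V E `` {a @ b})
      = (\<Union>a\<in>raag_cong V E `` {u}. \<Union>b\<in>raag_cong V E `` {w}. raag_cong V E `` {u @ w})"
    by (intro SUP_cong refl) auto
  also have "\<dots> = raag_cong V E `` {u @ w}"
    using raag_cong.refl[OF assms(1), of E] raag_cong.refl[OF assms(2), of E] by blast
  finally show ?thesis
    by (simp add: raag_def)
qed

lemma raag_inverse_word:
  assumes "w \<in> raag_words V"
  shows "\<exists>w'\<in>raag_words V. (w' @ w, []) \<in> raag_cong V E"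
  using assms
proof (induction w)
  case Nil
  have "[] \<in> raag_words V" by (simp add: raag_words_def)
  then show ?case using raag_cong.refl[of "[]" V E] by fastforce
next
  case (Cons x w)
  obtain v b where x: "x = (v, b)" by force
  from Cons obtain w' where w': "w' \<in> raag_words V" "(w' @ w, []) \<in> raag_cong V E"
    and v: "v \<in> V" and w: "w \<in> raag_words V"
    by (auto simp: raag_words_def x)
  have "([(v, \<not> b), (v, b)], []) \<in> raag_cong V E"
    using raag_cong.cancel[OF v, where b = "\<not> b"] by simp
  with w' w have "(w' @ ([(v, \<not> b), (v, b)] @ w), w' @ ([] @ w)) \<in> raag_cong V E"
    by (intro raag_cong.append raag_cong.refl)
  then have "((w' @ [(v, \<not> b)]) @ (x # w), w' @ w) \<in> raag_cong V E"
    by (simp add: x)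
  then have "((w' @ [(v, \<not> b)]) @ (x # w), []) \<in> raag_cong V E"
    using w'(2) by (rule raag_cong.trans)
  moreover have "w' @ [(v, \<not> b)] \<in> raag_words V"
    using w' v by (auto simp: raag_words_def)
  ultimately show ?case by blast
qed

lemma group_raag: "group (raag V E)"
proof (rule groupI)
  have car: "carrier (raag V E) = (\<lambda>w. raag_cong V E `` {w}) ` raag_words V"
    by (auto simp: raag_def quotient_def)
  have one: "\<one>\<^bsub>raag V E\<^esub> = raag_cong V E `` {[]}"
    by (simp add: raag_def)
  have nil: "[] \<in> raag_words V" by (simp add: raag_words_def)
  have app: "u @ w \<in> raag_words V" if "u \<in> raag_words V" "w \<in> raag_words V" for u w
    using that by (auto simp: raag_words_def)
  show "\<one>\<^bsub>raag V E\<^esub> \<in> carrier (raag V E)"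
    using nil by (auto simp: car one)
  fix x assume "x \<in> carrier (raag V E)"
  then obtain u where u: "u \<in> raag_words V" "x = raag_cong V E `` {u}"
    by (auto simp: car)
  show "\<one>\<^bsub>raag V E\<^esub> \<otimes>\<^bsub>raag V E\<^esub> x = x"
    using u nil by (simp add: one raag_mult_class)
  obtain u' where "u' \<in> raag_words V" "(u' @ u, []) \<in> raag_cong V E"
    using raag_inverse_word[OF u(1)] by blast
  then show "\<exists>y\<in>carrier (raag V E). y \<otimes>\<^bsub>raag V E\<^esub> x = \<one>\<^bsub>raag V E\<^esub>"
    using u equiv_class_eq[OF equiv_raag_cong, of "u' @ u" "[]"]
    by (intro bexI[of _ "raag_cong V E `` {u'}"]) (simp_all add: car one raag_mult_class)
  fix y assume "y \<in> carrier (raag V E)"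
  then obtain w where w: "w \<in> raag_words V" "y = raag_cong V E `` {w}"
    by (auto simp: car)
  show "x \<otimes>\<^bsub>raag V E\<^esub> y \<in> carrier (raag V E)"
    using u w app by (auto simp: car raag_mult_class)
  fix z assume "z \<in> carrier (raag V E)"
  then obtain t where t: "t \<in> raag_words V" "z = raag_cong V E `` {t}"
    by (auto simp: car)
  show "x \<otimes>\<^bsub>raag V E\<^esub> y \<otimes>\<^bsub>raag V E\<^esub> z = x \<otimes>\<^bsub>raag V E\<^esub> (y \<otimes>\<^bsub>raag V E\<^esub> z)"
    using u w t app by (simp add: raag_mult_class)
qed


section \<open>Extension graphs\<close>

definition conj_act :: "('g, 'm) monoid_scheme \<Rightarrow> 'g \<Rightarrow> 'g \<Rightarrow> 'g" where
  "conj_act G x g = inv\<^bsub>G\<^esub> g \<otimes>\<^bsub>G\<^esub> x \<otimes>\<^bsub>G\<^esub> g"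

definition ext_verts :: "'a set \<Rightarrow> ('a \<times> 'a) set \<Rightarrow> ('a \<times> bool) list set set" where
  "ext_verts V E =
    {conj_act (raag V E) (raag_gen V E v) g | v g. v \<in> V \<and> g \<in> carrier (raag V E)}"

definition ext_edges ::
    "'a set \<Rightarrow> ('a \<times> 'a) set \<Rightarrow> (('a \<times> bool) list set \<times> ('a \<times> bool) list set) set" where
  "ext_edges V E =
    {(x, y). x \<in> ext_verts V E \<and> y \<in> ext_verts V E \<and> x \<noteq> y \<and>
      x \<otimes>\<^bsub>raag V E\<^esub> y = y \<otimes>\<^bsub>raag V E\<^esub> x}"

definition ext_dist ::
    "'a set \<Rightarrow> ('a \<times> 'a) set \<Rightarrow> ('a \<times> bool) list set \<Rightarrow> ('a \<times> bool) list set \<Rightarrow> real" where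
  "ext_dist V E x y = real (graph_dist (ext_edges V E) x y)"


section \<open>Asymptotic translation lengths\<close>

text \<open>
  Here \<open>X\<close> is the underlying set of a nonempty metric space with distance function \<open>dX\<close>, and
  \<open>act x g\<close> is the image of \<open>x\<close> under \<open>g\<close> for an isometric right action of \<open>G\<close>.
\<close>

definition asymp_transl_length ::
    "('g, 'm) monoid_scheme \<Rightarrow> ('x \<Rightarrow> 'g \<Rightarrow> 'x) \<Rightarrow> 'x set \<Rightarrow> ('x \<Rightarrow> 'x \<Rightarrow> real) \<Rightarrow> 'g \<Rightarrow> real" where
  "asymp_transl_length G act X dX g =
    (THE t. \<forall>x\<in>X. (\<lambda>n. dX (act x (g [^]\<^bsub>G\<^esub> (n::nat))) x / real n) \<longlonglongrightarrow> t)"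

text \<open>
  The minimum is a genuine one, not an infimum: \<^const>\<open>Least\<close> on the reals is determined
  only when a least element exists, so a bound on it includes attainment.
\<close>

definition min_asymp_transl_length ::
    "('g, 'm) monoid_scheme \<Rightarrow> ('x \<Rightarrow> 'g \<Rightarrow> 'x) \<Rightarrow> 'x set \<Rightarrow> ('x \<Rightarrow> 'x \<Rightarrow> real) \<Rightarrow> real" where
  "min_asymp_transl_length G act X dX =
    (LEAST t. t \<in> {asymp_transl_length G act X dX g | g.
       g \<in> carrier G \<and> asymp_transl_length G act X dX g > 0})"

end

theory Submission
  imports Defs "HOL-Library.Sublist"
begin

text \<open>
  Two things have to be shown: the positive translation lengths have a least element, and some
  element has positive translation length at most \<open>2 / (d - 2)\<close>. Both rest on one description of
  distances. Since the centralizer of a generator \<open>v\<close> is generated by the star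
  of \<open>v\<close>, a path of length \<open>n\<close> in the extension graph from \<open>v\<close> to \<open>v\<^sup>g\<close> is the same thing as a
  closed walk \<open>v = v\<^sub>0, \<dots>, v\<^sub>n = v\<close> in \<open>\<Gamma>\<close> together with a factorization \<open>g = s\<^sub>n \<cdots> s\<^sub>0\<close> in which
  \<open>s\<^sub>i\<close> is a word in the star of \<open>v\<^sub>i\<close> (\<open>path_iff_star_walk\<close>). Two words that differ by
  commutations have the same projections to all pairs of non-commuting vertices, and letting
  letters act on such projections solves the word problem; it shows that a word without
  cancellations embeds, up to commutation, as a scattered subword into every word for the same
  element (\<open>cancel_free_subseq\<close>).

  Deleting letters from a factorization into star words leaves a factorization into star words.
  Hence the translation length of a scattered subword of a cyclically reduced word \<open>h\<close> is at most
  that of \<open>h\<close> (\<open>transl_length_subseq_le\<close>). Whether the translation length of a cyclically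
  reduced word is positive depends only on the set of vertices that occur: it vanishes if this set lies in a star or splits as a
  join (\<open>spread_if_transl_length_pos\<close>). Otherwise it is positive for every word that uses each
  vertex of the set exactly once, because every star word misses some vertex of the set while in
  powers of the word the occurrences of non-adjacent vertices alternate, so that each star word
  contributes only boundedly many letters (\<open>transl_length_pos\<close>). Every element is
  conjugate to a cyclically reduced word, and in that word one occurrence of each vertex can be
  kept. So every positive translation length is bounded below by a positive translation length
  of one of the finitely many words without repeated vertices, and the minimum is attained there
  (\<open>min_transl_length_le\<close>).

  For the upper bound choose \<open>v\<close> and \<open>x\<close> at distance \<open>d\<close> in the complement graph and let \<open>g\<close> be
  the product of all vertices, ordered by their distance from \<open>v\<close> in the complement graph. Vertices
  whose distances differ by at least two commute. Therefore \<open>g\<^sup>q = X Y\<close> with \<open>X\<close> supported on levels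
  at most \<open>q\<close> and \<open>Y\<close> on levels at least two (\<open>power_factorization\<close>). For \<open>q = d - 2\<close> the factor
  \<open>X\<close> lies in the star of \<open>x\<close> and \<open>Y\<close> in the star of \<open>v\<close>; as \<open>v\<close> and \<open>x\<close> are adjacent, each
  \<open>g\<^sup>q\<close> costs two steps (\<open>transl_length_le_two_stars\<close>).
\<close>

section \<open>Words up to commutation\<close>

abbreviation flip :: "'a \<times> bool \<Rightarrow> 'a \<times> bool" where
  "flip x \<equiv> (fst x, \<not> snd x)"

definition commutes_past :: "('a \<times> 'a) set \<Rightarrow> 'a \<times> bool \<Rightarrow> ('a \<times> bool) list \<Rightarrow> bool" where
  "commutes_past E x q \<longleftrightarrow> (\<forall>y\<in>set q. (fst x, fst y) \<in> E)"

text \<open>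
  The subwords on pairs of non-adjacent vertices; the pair \<open>(a, a)\<close> is included. The value on
  adjacent pairs is a dummy, so that equality of the functions expresses equality up to
  commutation (the Projection Lemma of trace theory).
\<close>

definition projections :: "('a \<times> 'a) set \<Rightarrow> ('a \<times> bool) list \<Rightarrow> 'a \<Rightarrow> 'a \<Rightarrow> ('a \<times> bool) list" where
  "projections E w a b = (if (a, b) \<in> E then [] else filter (\<lambda>x. fst x = a \<or> fst x = b) w)"

text \<open>
  For the projections of a word this says that \<open>x\<close> can be moved to the front by commutations
  (\<open>leads_projections_iff\<close>). Stating it for an arbitrary \<open>f\<close> makes the letter action below
  a function of the projections alone.
\<close>

definition leads :: "('a \<times> 'a) set \<Rightarrow> 'a \<times> bool \<Rightarrow> ('a \<Rightarrow> 'a \<Rightarrow> ('a \<times> bool) list) \<Rightarrow> bool" where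
  "leads E x f \<longleftrightarrow> (\<forall>b. (fst x, b) \<notin> E \<longrightarrow> (\<exists>t. f (fst x) b = x # t))"

text \<open>
  No cancelling pair, even after commutations. The letters of \<open>q\<close> are adjacent to \<open>x\<close>, hence
  their vertices differ from that of \<open>x\<close>, so \<open>x\<close> and its inverse form an innermost pair.
\<close>

definition cancel_free :: "('a \<times> 'a) set \<Rightarrow> ('a \<times> bool) list \<Rightarrow> bool" where
  "cancel_free E w \<longleftrightarrow> \<not> (\<exists>p x q r. w = p @ x # q @ flip x # r \<and> commutes_past E x q)"

text \<open>
  Left multiplication by \<open>x\<close> on projections of words without cancellations: \<open>x\<close> cancels against
  a leading inverse if there is one and is put in front otherwise.
\<close>

definition letter_act :: "('a \<times> 'a) set \<Rightarrow> 'a \<times> bool \<Rightarrow>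
    ('a \<Rightarrow> 'a \<Rightarrow> ('a \<times> bool) list) \<Rightarrow> 'a \<Rightarrow> 'a \<Rightarrow> ('a \<times> bool) list" where
  "letter_act E x f a b =
    (if (a, b) \<in> E \<or> fst x \<notin> {a, b} then f a b
     else if leads E (flip x) f then tl (f a b) else x # f a b)"

lemma commutes_past_simps [simp]:
  "commutes_past E x []"
  "commutes_past E x (y # q) \<longleftrightarrow> (fst x, fst y) \<in> E \<and> commutes_past E x q"
  "commutes_past E x (p @ q) \<longleftrightarrow> commutes_past E x p \<and> commutes_past E x q"
  by (auto simp: commutes_past_def)

lemma commutes_past_flip [simp]: "commutes_past E (flip x) = commutes_past E x"
  by (auto simp: commutes_past_def fun_eq_iff)

lemma set_subseq: "subseq u w \<Longrightarrow> set u \<subseteq> set w"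
  by (auto elim: list_emb_set)

lemma commutes_past_subseq: "subseq q' q \<Longrightarrow> commutes_past E x q \<Longrightarrow> commutes_past E x q'"
  using set_subseq by (fastforce simp: commutes_past_def)

lemma projections_Nil [simp]: "projections E [] = (\<lambda>a b. [])"
  by (auto simp: projections_def fun_eq_iff)

lemma projections_append: "projections E (u @ w) a b = projections E u a b @ projections E w a b"
  by (auto simp: projections_def)

lemma projections_append_cong:
  "projections E u = projections E u' \<Longrightarrow> projections E w = projections E w' \<Longrightarrow> projections E (u @ w) = projections E (u' @ w')"
  by (auto simp: fun_eq_iff projections_append)

lemma projections_Cons:
  "projections E (x # w) a b = (if (a, b) \<notin> E \<and> fst x \<in> {a, b} then x # projections E w a b else projections E w a b)"
  by (auto simp: projections_def)

lemma projections_Cons_cong: "projections E u = projections E w \<Longrightarrow> projections E (x # u) = projections E (x # w)"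
  using projections_append_cong[of E "[x]" "[x]" u w] by simp

lemma projections_Cons_cancel: "projections E (x # u) = projections E (x # w) \<longleftrightarrow> projections E u = projections E w"
  by (auto simp: fun_eq_iff projections_Cons split: if_splits)

locale simplicial =
  fixes V :: "'a set" and E :: "('a \<times> 'a) set"
  assumes simplicial: "simplicial_graph V E"
begin

lemma E_sym: "(u, v) \<in> E \<Longrightarrow> (v, u) \<in> E"
  using simplicial by (auto simp: simplicial_graph_def dest: symD)

lemma E_irrefl [simp]: "(u, u) \<notin> E"
  using simplicial by (auto simp: simplicial_graph_def irrefl_def)

lemma E_verts: "(u, v) \<in> E \<Longrightarrow> u \<in> V \<and> v \<in> V"
  using simplicial by (auto simp: simplicial_graph_def)

lemma projections_move:
  assumes "commutes_past E x q"
  shows "projections E (q @ x # r) = projections E (x # q @ r)"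
proof (intro ext)
  fix a b
  show "projections E (q @ x # r) a b = projections E (x # q @ r) a b"
  proof (cases "(a, b) \<notin> E \<and> fst x \<in> {a, b}")
    case True
    have "projections E q a b = []"
      using assms True E_sym by (auto simp: projections_def commutes_past_def filter_empty_conv)
    then show ?thesis by (simp add: projections_append projections_Cons)
  qed (auto simp: projections_append projections_Cons)
qed

text \<open>
  The projection to \<open>(fst x, fst x)\<close> locates the first occurrence of the vertex of \<open>x\<close>; a letter
  before it that does not commute with \<open>x\<close> would come first in its own projection.
\<close>

lemma leads_projections_iff: "leads E x (projections E w) \<longleftrightarrow> (\<exists>q r. w = q @ x # r \<and> commutes_past E x q)"
proof
  assume l: "leads E x (projections E w)"
  then obtain t where "filter (\<lambda>y. fst y = fst x) w = x # t"
    by (auto simp: leads_def projections_def dest!: spec[of _ "fst x"])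
  then obtain q r where w: "w = q @ x # r" and q: "\<forall>y\<in>set q. fst y \<noteq> fst x"
    by (auto dest!: filter_eq_ConsD)
  have "(fst x, fst y) \<in> E" if y: "y \<in> set q" for y
  proof (rule ccontr)
    assume n: "(fst x, fst y) \<notin> E"
    let ?P = "\<lambda>z. fst z = fst x \<or> fst z = fst y"
    obtain t where "filter ?P w = x # t"
      using l n by (auto simp: leads_def projections_def dest!: spec[of _ "fst y"])
    moreover have "filter ?P q \<noteq> []" using y by (auto simp: filter_empty_conv)
    ultimately have "hd (filter ?P q) = x" by (cases "filter ?P q") (auto simp: w)
    with \<open>filter ?P q \<noteq> []\<close> have "x \<in> set q"
      by (metis filter_is_subset hd_in_set subsetD)
    with q show False by blast
  qed
  with w show "\<exists>q r. w = q @ x # r \<and> commutes_past E x q"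
    by (auto simp: commutes_past_def)
next
  assume "\<exists>q r. w = q @ x # r \<and> commutes_past E x q"
  then obtain q r where "w = q @ x # r" "commutes_past E x q" by blast
  then have "projections E w = projections E (x # q @ r)" by (simp add: projections_move)
  then show "leads E x (projections E w)" by (auto simp: leads_def projections_Cons)
qed

lemma letter_act_cancel:
  assumes "commutes_past E x q"
  shows "letter_act E x (projections E (q @ flip x # r)) = projections E (q @ r)"
proof -
  have *: "commutes_past E (flip x) q" using assms by (simp add: commutes_past_def)
  then have l: "leads E (flip x) (projections E (q @ flip x # r))"
    by (subst leads_projections_iff) blast
  show ?thesis
    using l unfolding projections_move[OF *] by (auto simp: fun_eq_iff letter_act_def projections_Cons)
qed

lemma letter_act_Cons:
  assumes "\<not> leads E (flip x) (projections E w)"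
  shows "letter_act E x (projections E w) = projections E (x # w)"
  using assms by (auto simp: fun_eq_iff letter_act_def projections_Cons)

lemma cancel_free_Cons_iff: "cancel_free E (x # w) \<longleftrightarrow> cancel_free E w \<and> \<not> leads E (flip x) (projections E w)"
proof
  assume c: "cancel_free E (x # w)"
  have "cancel_free E w"
    unfolding cancel_free_def
  proof clarify
    fix p v b q r
    assume "w = p @ (v, b) # q @ flip (v, b) # r" "commutes_past E (v, b) q"
    then have "x # w = (x # p) @ (v, b) # q @ flip (v, b) # r" by simp
    with c \<open>commutes_past E (v, b) q\<close> show False unfolding cancel_free_def by blast
  qed
  moreover have "\<not> leads E (flip x) (projections E w)"
  proof
    assume "leads E (flip x) (projections E w)"
    then obtain q r where "w = q @ flip x # r" "commutes_past E x q"
      by (auto simp: leads_projections_iff)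
    then have "x # w = [] @ x # q @ flip x # r" by simp
    with c \<open>commutes_past E x q\<close> show False unfolding cancel_free_def by blast
  qed
  ultimately show "cancel_free E w \<and> \<not> leads E (flip x) (projections E w)" ..
next
  assume c: "cancel_free E w \<and> \<not> leads E (flip x) (projections E w)"
  show "cancel_free E (x # w)"
    unfolding cancel_free_def
  proof (intro notI, elim exE conjE)
    fix p y q r
    assume e: "x # w = p @ y # q @ flip y # r" and q: "commutes_past E y q"
    show False
    proof (cases p)
      case Nil
      with e have "w = q @ flip x # r" "y = x" by auto
      with c q show False by (auto simp: leads_projections_iff)
    next
      case (Cons z p')
      with e have "w = p' @ y # q @ flip y # r" by simp
      with c q show False unfolding cancel_free_def by blast
    qed
  qed
qed

section \<open>The action of letters and the word problem\<close>

lemma cancel_free_Nil [simp]: "cancel_free E []"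
  by (simp add: cancel_free_def)

lemma projections_eq_Nil_iff: "projections E w = projections E [] \<longleftrightarrow> w = []"
proof
  assume "projections E w = projections E []"
  then have "projections E w (fst (hd w)) (fst (hd w)) = []" by simp
  then show "w = []" by (cases w) (auto simp: projections_def)
qed simp

lemma projections_eq_set:
  assumes "projections E u = projections E w"
  shows "set u = set w"
proof -
  have "x \<in> set t \<longleftrightarrow> x \<in> set (projections E t (fst x) (fst x))" for t x
    by (auto simp: projections_def)
  from this[of _ u] this[of _ w] show ?thesis unfolding assms by blast
qed

text \<open>
  Deleting a leading letter creates no cancelling pair: a new pair would have to straddle the
  deleted letter without commuting with it, but its left member does commute with it.
\<close>

lemma cancel_free_delete:
  assumes "cancel_free E (q @ x # r)" "commutes_past E x q"
  shows "cancel_free E (q @ r)"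
  using assms
proof (induction q)
  case Nil
  then show ?case by (simp add: cancel_free_Cons_iff)
next
  case (Cons y q)
  then have xy: "(fst x, fst y) \<in> E" and q: "commutes_past E x q"
    and c: "cancel_free E (q @ x # r)" and n: "\<not> leads E (flip y) (projections E (q @ x # r))"
    by (auto simp: cancel_free_Cons_iff)
  have "leads E (flip y) (projections E (x # q @ r))" if "leads E (flip y) (projections E (q @ r))"
    using that xy E_sym by (auto simp: leads_def projections_Cons)
  with n have "\<not> leads E (flip y) (projections E (q @ r))"
    by (auto simp: projections_move[OF q])
  with Cons.IH[OF c q] show ?case by (simp add: cancel_free_Cons_iff)
qed

lemma letter_act_closed:
  assumes "cancel_free E w"
  obtains w' where "cancel_free E w'" "letter_act E x (projections E w) = projections E w'"
    "subseq w' (x # w)"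
proof (cases "leads E (flip x) (projections E w)")
  case True
  then obtain q r where w: "w = q @ flip x # r" and q: "commutes_past E x q"
    by (auto simp: leads_projections_iff)
  show ?thesis
  proof
    show "cancel_free E (q @ r)"
      using cancel_free_delete[of q "flip x" r] assms q w by simp
    show "letter_act E x (projections E w) = projections E (q @ r)"
      using letter_act_cancel[OF q] w by simp
    have "subseq (q @ r) (q @ [flip x] @ r)" by (intro list_emb_append_mono) auto
    then show "subseq (q @ r) (x # w)" by (auto simp: w)
  qed
next
  case False
  then show ?thesis
    using assms letter_act_Cons by (intro that[of "x # w"]) (simp_all add: cancel_free_Cons_iff)
qed

text \<open>
  If \<open>x\<close> cancels a leading inverse, then the remaining word cannot start with \<open>x\<close>, as that
  \<open>x\<close> would already have cancelled against the same inverse. This is where freedom from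
  cancellations enters.
\<close>

lemma letter_act_inverse:
  assumes "cancel_free E w"
  shows "letter_act E (flip x) (letter_act E x (projections E w)) = projections E w"
proof (cases "leads E (flip x) (projections E w)")
  case True
  then obtain q r where w: "w = q @ flip x # r" and q: "commutes_past E x q"
    by (auto simp: leads_projections_iff)
  have "\<not> leads E x (projections E (q @ r))"
  proof
    assume "leads E x (projections E (q @ r))"
    then obtain q' r' where e: "q @ r = q' @ x # r'" and q': "commutes_past E x q'"
      by (auto simp: leads_projections_iff)
    have "x \<notin> set q" using q by (auto simp: commutes_past_def)
    with e obtain t where "q' = q @ t" "r = t @ x # r'"
      by (auto simp: append_eq_append_conv2 append_eq_Cons_conv)
    with w q' have "w = q @ flip x # t @ flip (flip x) # r'" "commutes_past E (flip x) t" by auto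
    with assms show False unfolding cancel_free_def by blast
  qed
  then have "letter_act E (flip x) (projections E (q @ r)) = projections E (flip x # q @ r)"
    using letter_act_Cons[of "flip x" "q @ r"] by simp
  also have "\<dots> = projections E w"
    using projections_move[of "flip x" q r] q w by simp
  finally show ?thesis using letter_act_cancel[OF q] w by simp
next
  case False
  then show ?thesis
    using letter_act_cancel[of "flip x" "[]" w] by (simp add: letter_act_Cons)
qed

text \<open>
  Adjacent vertices never lie in a common non-adjacent pair, so the two letters change disjoint
  sets of projections.
\<close>

lemma letter_act_commute:
  assumes "(fst x, fst y) \<in> E"
  shows "letter_act E x (letter_act E y f) = letter_act E y (letter_act E x f)"
proof -
  have "letter_act E y f (fst x) b = f (fst x) b" if "(fst x, b) \<notin> E" for b
    using assms that by (auto simp: letter_act_def)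
  then have lx: "leads E (flip x) (letter_act E y f) = leads E (flip x) f"
    by (simp add: leads_def)
  have "letter_act E x f (fst y) b = f (fst y) b" if "(fst y, b) \<notin> E" for b
    using assms that E_sym by (auto simp: letter_act_def)
  then have ly: "leads E (flip y) (letter_act E x f) = leads E (flip y) f"
    by (simp add: leads_def)
  have miss: "letter_act E z g a b = g a b" if "(a, b) \<in> E \<or> fst z \<notin> {a, b}" for z g a b
    using that by (auto simp: letter_act_def)
  have hit: "letter_act E z g a b = (if leads E (flip z) g then tl (g a b) else z # g a b)"
    if "\<not> ((a, b) \<in> E \<or> fst z \<notin> {a, b})" for z g a b
    using that by (auto simp: letter_act_def)
  show ?thesis
  proof (intro ext)
    fix a b
    let ?m = "\<lambda>z. (a, b) \<in> E \<or> fst z \<notin> {a, b}"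
    have "?m x \<or> ?m y" using assms E_sym[OF assms] by auto
    then consider "?m x" "?m y" | "?m x" "\<not> ?m y" | "\<not> ?m x" "?m y" by blast
    then show "letter_act E x (letter_act E y f) a b = letter_act E y (letter_act E x f) a b"
    proof cases
      case 1
      then show ?thesis by (simp only: miss)
    next
      case 2
      then show ?thesis by (simp only: miss[OF 2(1)] hit[OF 2(2)] ly)
    next
      case 3
      then show ?thesis by (simp only: miss[OF 3(2)] hit[OF 3(1)] lx)
    qed
  qed
qed

definition word_act :: "('a \<times> bool) list \<Rightarrow> ('a \<Rightarrow> 'a \<Rightarrow> ('a \<times> bool) list) \<Rightarrow> 'a \<Rightarrow> 'a \<Rightarrow> ('a \<times> bool) list"
  where "word_act = foldr (letter_act E)"

lemma word_act_simps [simp]: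
  "word_act [] f = f"
  "word_act (x # w) f = letter_act E x (word_act w f)"
  "word_act (u @ w) f = word_act u (word_act w f)"
  by (simp_all add: word_act_def)

lemma word_act_closed:
  assumes "cancel_free E w"
  shows "\<exists>w'. cancel_free E w' \<and> word_act s (projections E w) = projections E w' \<and> subseq w' (s @ w)"
proof (induction s)
  case Nil
  show ?case using assms by (intro exI[of _ w]) simp
next
  case (Cons x s)
  then obtain w' where w': "cancel_free E w'" "word_act s (projections E w) = projections E w'"
    "subseq w' (s @ w)" by blast
  obtain w'' where w'': "cancel_free E w''" "letter_act E x (projections E w') = projections E w''"
    "subseq w'' (x # w')" using letter_act_closed[OF w'(1)] by blast
  have "subseq w'' (x # s @ w)"
    using w''(3) w'(3) by (meson subseq_Cons2 subseq_order.trans)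
  then show ?case using w'(2) w''(1,2) by (intro exI[of _ w'']) simp
qed

text \<open>
  The letter action respects the defining relations, hence is an invariant of the group element.
\<close>

lemma word_act_cong:
  "(s, s') \<in> raag_cong V E \<Longrightarrow> cancel_free E w \<Longrightarrow>
    word_act s (projections E w) = word_act s' (projections E w)"
proof (induction arbitrary: w rule: raag_cong.induct)
  case (append u u' t t')
  obtain w' where w': "cancel_free E w'" "word_act t (projections E w) = projections E w'"
    using word_act_closed[OF append.prems] by blast
  have "word_act (u @ t) (projections E w) = word_act u' (word_act t (projections E w))"
    using append.IH(1)[OF w'(1)] w'(2) by simp
  then show ?case using append.IH(2)[OF append.prems] by simp
next
  case (cancel v b)
  then show ?case using letter_act_inverse[of w "(v, \<not> b)"] by simp
next
  case (commute u v)
  then show ?case using letter_act_commute[of "(u, True)" "(v, True)"] by simp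
qed auto

lemma word_act_cancel_free:
  "cancel_free E w \<Longrightarrow> word_act w (projections E []) = projections E w"
  by (induction w) (auto simp: cancel_free_Cons_iff letter_act_Cons simp del: projections_Nil)

text \<open>
  A word without cancellations is recovered from any representative \<open>s\<close> of its group element by
  letting \<open>s\<close> act on the empty word, and each step of that action adds the current letter of \<open>s\<close> or
  deletes an earlier one.
\<close>

theorem cancel_free_subseq:
  assumes "cancel_free E w" "(w, s) \<in> raag_cong V E"
  shows "\<exists>s'. subseq s' s \<and> projections E s' = projections E w"
proof -
  have "projections E w = word_act s (projections E [])"
    using word_act_cancel_free[OF assms(1)] word_act_cong[OF assms(2) cancel_free_Nil] by simp
  then show ?thesis using word_act_closed[OF cancel_free_Nil, of s] by auto
qed

text \<open>
  Words with equal projections have corresponding occurrences of letters, so a deletion in one of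
  them can be copied in the other.
\<close>

lemma projections_subseq_transfer:
  "projections E s = projections E w \<Longrightarrow> subseq w' w \<Longrightarrow>
    \<exists>s'. subseq s' s \<and> projections E s' = projections E w'"
proof (induction w arbitrary: s w')
  case Nil
  then have "w' = []" by (cases w') auto
  then show ?case by (intro exI[of _ "[]"]) simp
next
  case (Cons x w)
  have "leads E x (projections E (x # w))" by (simp add: leads_def projections_Cons)
  with Cons.prems(1) have "leads E x (projections E s)" by simp
  then obtain q r where s: "s = q @ x # r" and q: "commutes_past E x q"
    by (auto simp: leads_projections_iff)
  then have eq: "projections E (q @ r) = projections E w"
    using Cons.prems(1) by (simp add: projections_move projections_Cons_cancel)
  have sub: "subseq (q @ r) s" unfolding s by (intro list_emb_append_mono) auto
  show ?case
  proof (cases "\<exists>w''. w' = x # w'' \<and> subseq w'' w")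
    case True
    then obtain w'' where w'': "w' = x # w''" "subseq w'' w" by blast
    obtain t where t: "subseq t (q @ r)" "projections E t = projections E w''"
      using Cons.IH[OF eq w''(2)] by blast
    obtain t1 t2 where tt: "t = t1 @ t2" "subseq t1 q" "subseq t2 r"
      using t(1) by (auto elim: subseq_appendE)
    have "subseq (t1 @ x # t2) s"
      unfolding s using tt by (intro list_emb_append_mono) auto
    moreover have "projections E (t1 @ x # t2) = projections E w'"
      using projections_move[OF commutes_past_subseq[OF tt(2) q], of t2] t(2) tt(1) w''(1)
      by (simp add: projections_Cons_cancel)
    ultimately show ?thesis by blast
  next
    case False
    with Cons.prems(2) have "subseq w' w" by (auto elim: list_emb.cases)
    from Cons.IH[OF eq this] sub show ?thesis by (meson subseq_order.trans)
  qed
qed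

corollary subseq_of_cancel_free:
  assumes "cancel_free E w" "(w, s) \<in> raag_cong V E" "subseq w' w"
  shows "\<exists>s'. subseq s' s \<and> projections E s' = projections E w'"
  using cancel_free_subseq[OF assms(1,2)] projections_subseq_transfer[OF _ assms(3)]
  by (meson subseq_order.trans)

section \<open>Calculating in the right-angled Artin group\<close>

abbreviation "A \<equiv> raag V E"
abbreviation "W \<equiv> raag_words V"

definition el :: "('a \<times> bool) list \<Rightarrow> ('a \<times> bool) list set" where
  "el w = raag_cong V E `` {w}"

definition winv :: "('a \<times> bool) list \<Rightarrow> ('a \<times> bool) list" where
  "winv w = rev (map flip w)"

lemma words_iff: "w \<in> raag_words U \<longleftrightarrow> fst ` set w \<subseteq> U"
  by (simp add: raag_words_def in_lists_conv_set mem_Times_iff image_subset_iff)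

lemma words_simps [simp]:
  "[] \<in> raag_words U"
  "x # w \<in> raag_words U \<longleftrightarrow> fst x \<in> U \<and> w \<in> raag_words U"
  "u @ w \<in> raag_words U \<longleftrightarrow> u \<in> raag_words U \<and> w \<in> raag_words U"
  "winv w \<in> raag_words U \<longleftrightarrow> w \<in> raag_words U"
  by (simp_all add: words_iff winv_def image_Un image_image)

lemma words_subseq: "subseq u w \<Longrightarrow> w \<in> raag_words U \<Longrightarrow> u \<in> raag_words U"
  using set_subseq by (fastforce simp: words_iff)

lemma el_eq_iff: "u \<in> W \<Longrightarrow> w \<in> W \<Longrightarrow> el u = el w \<longleftrightarrow> (u, w) \<in> raag_cong V E"
  unfolding el_def by (rule eq_equiv_class_iff[OF equiv_raag_cong])

lemma el_append: "u \<in> W \<Longrightarrow> w \<in> W \<Longrightarrow> el (u @ w) = el u \<otimes>\<^bsub>A\<^esub> el w"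
  by (simp add: el_def raag_mult_class)

lemma carrier_A: "carrier A = el ` W"
  by (auto simp: raag_def quotient_def el_def)

lemma el_carrier [simp]: "w \<in> W \<Longrightarrow> el w \<in> carrier A"
  by (simp add: carrier_A)

lemma one_A: "\<one>\<^bsub>A\<^esub> = el []"
  by (simp add: raag_def el_def)

sublocale A: group A
  by (rule group_raag)

lemma el_winv:
  assumes "w \<in> W"
  shows "el (winv w) = inv\<^bsub>A\<^esub> (el w)"
proof -
  have "el (winv w @ w) = el []"
    using assms
  proof (induction w)
    case (Cons x w)
    have "el [flip x, x] = el []"
      using Cons.prems raag_cong.cancel[of "fst x" V "\<not> snd x" E] by (subst el_eq_iff) auto
    then have pair: "el [flip x, x] = \<one>\<^bsub>A\<^esub>"
      by (simp only: one_A)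
    have "el (winv w @ [flip x, x] @ w) = el (winv w) \<otimes>\<^bsub>A\<^esub> (el [flip x, x] \<otimes>\<^bsub>A\<^esub> el w)"
      using Cons.prems el_append[of "winv w" "[flip x, x] @ w"] el_append[of "[flip x, x]" w]
      by simp
    also have "\<dots> = el (winv w @ w)"
      using Cons.prems el_append[of "winv w" w] by (simp only: pair) simp
    finally have "el (winv w @ [flip x, x] @ w) = el (winv w @ w)" .
    with Cons show ?case by (simp add: winv_def)
  qed (simp add: winv_def)
  then show ?thesis
    using assms by (intro A.inv_equality[symmetric]) (auto simp: one_A el_append)
qed

end

lemma (in group) commute_inv:
  assumes "x \<in> carrier G" "y \<in> carrier G" "x \<otimes> y = y \<otimes> x"
  shows "inv x \<otimes> y = y \<otimes> inv x"
proof -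
  have "inv x \<otimes> y = inv x \<otimes> (y \<otimes> x) \<otimes> inv x"
    using assms(1,2) by (simp add: m_assoc)
  also have "\<dots> = y \<otimes> inv x"
    using assms(1,2) by (simp add: m_assoc[symmetric] flip: assms(3))
  finally show ?thesis .
qed

context simplicial
begin

lemma el_letters_commute:
  assumes "(fst x, fst y) \<in> E"
  shows "el [x, y] = el [y, x]"
proof -
  obtain u b v c where xy: "x = (u, b)" "y = (v, c)" by force
  have uv: "u \<in> V" "v \<in> V" using assms E_verts xy by auto
  have inv: "el [(w, False)] = inv\<^bsub>A\<^esub> (el [(w, True)])" if "w \<in> V" for w
    using el_winv[of "[(w, True)]"] that by (simp add: winv_def)
  let ?a = "el [(u, True)]" and ?b = "el [(v, True)]"
  have "el [(u, True), (v, True)] = el [(v, True), (u, True)]"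
    using assms raag_cong.commute[of u V v E] uv xy by (subst el_eq_iff) auto
  then have c: "?a \<otimes>\<^bsub>A\<^esub> ?b = ?b \<otimes>\<^bsub>A\<^esub> ?a"
    using uv by (simp flip: el_append)
  have ab: "?a \<in> carrier A" "?b \<in> carrier A" using uv by auto
  have "el [(u, b)] \<otimes>\<^bsub>A\<^esub> el [(v, c)] = el [(v, c)] \<otimes>\<^bsub>A\<^esub> el [(u, b)]"
    using c ab uv A.commute_inv[of ?a ?b] A.commute_inv[of ?b ?a]
      A.commute_inv[of ?b "inv\<^bsub>A\<^esub> ?a"] by (cases b; cases c) (simp_all add: inv)
  then show ?thesis using uv xy by (simp flip: el_append)
qed

lemma el_append_cong:
  "u \<in> W \<Longrightarrow> u' \<in> W \<Longrightarrow> w \<in> W \<Longrightarrow> w' \<in> W \<Longrightarrow> el u = el u' \<Longrightarrow> el w = el w' \<Longrightarrow>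
    el (u @ w) = el (u' @ w')"
  by (simp add: el_append)

lemma el_commutes_past:
  assumes "commutes_past E x q" "x # q \<in> W"
  shows "el (q @ [x]) = el (x # q)"
  using assms
proof (induction q)
  case (Cons y q)
  have "el (y # q @ [x]) = el (y # x # q)"
    using Cons el_append_cong[of "[y]" "[y]" "q @ [x]" "x # q"] by simp
  also have "\<dots> = el (x # y # q)"
    using Cons el_letters_commute[of x y] el_append_cong[of "[y, x]" "[x, y]" q q] by simp
  finally show ?case by simp
qed simp

text \<open>
  Equal projections arise from commutations: the first letter of \<open>u\<close> can be moved to the front
  of \<open>w\<close>.
\<close>

lemma projections_imp_el:
  assumes "projections E u = projections E w" "u \<in> W" "w \<in> W"
  shows "el u = el w"
  using assms
proof (induction u arbitrary: w)
  case Nil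
  then show ?case using projections_eq_Nil_iff by metis
next
  case (Cons x u)
  have "leads E x (projections E (x # u))" by (simp add: leads_def projections_Cons)
  with Cons.prems(1) have "leads E x (projections E w)" by simp
  then obtain q r where w: "w = q @ x # r" and q: "commutes_past E x q"
    by (auto simp: leads_projections_iff)
  then have eq: "projections E u = projections E (q @ r)"
    using Cons.prems(1) by (simp add: projections_move projections_Cons_cancel)
  have "el w = el (x # q @ r)"
    using el_append_cong[of "q @ [x]" "x # q" r r] el_commutes_past[OF q] Cons.prems w by simp
  also have "\<dots> = el (x # u)"
    using el_append_cong[of "[x]" "[x]" "q @ r" u] Cons.IH[OF eq] Cons.prems w by simp
  finally show ?case by simp
qed

end

context simplicial
begin

section \<open>Centralizers of conjugates of generators\<close>

definition star :: "'a \<Rightarrow> 'a set" where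
  "star v = {u \<in> V. u = v \<or> (v, u) \<in> E}"

text \<open>
  The vertex \<open>v\<^sup>g\<close> of the extension graph.
\<close>

definition vtx :: "'a \<Rightarrow> ('a \<times> bool) list \<Rightarrow> ('a \<times> bool) list set" where
  "vtx v g = conj_act A (raag_gen V E v) (el g)"

lemma star_subset: "star v \<subseteq> V"
  by (auto simp: star_def)

lemma star_words: "s \<in> raag_words (star v) \<Longrightarrow> s \<in> W"
  using star_subset by (auto simp: words_iff)

lemma winv_simps [simp]:
  "winv [] = []" "winv (x # w) = winv w @ [flip x]" "winv (u @ w) = winv w @ winv u"
  "winv (winv w) = w"
  by (auto simp: winv_def rev_map[symmetric] comp_def)

lemma set_winv: "set (winv w) = flip ` set w"
  by (simp add: winv_def)

lemma gen_el: "raag_gen V E v = el [(v, True)]"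
  by (simp add: raag_gen_def el_def)

lemma conj_act_mult:
  assumes "x \<in> carrier A" "g \<in> carrier A" "h \<in> carrier A"
  shows "conj_act A x (g \<otimes>\<^bsub>A\<^esub> h) = conj_act A (conj_act A x g) h"
  using assms by (simp add: conj_act_def A.inv_mult_group A.m_assoc)

lemma conj_act_one: "x \<in> carrier A \<Longrightarrow> conj_act A x \<one>\<^bsub>A\<^esub> = x"
  by (simp add: conj_act_def)

lemma conj_act_hom:
  assumes "x \<in> carrier A" "y \<in> carrier A" "g \<in> carrier A"
  shows "conj_act A x g \<otimes>\<^bsub>A\<^esub> conj_act A y g = conj_act A (x \<otimes>\<^bsub>A\<^esub> y) g"
proof -
  have "conj_act A x g \<otimes>\<^bsub>A\<^esub> conj_act A y g =
      inv\<^bsub>A\<^esub> g \<otimes>\<^bsub>A\<^esub> x \<otimes>\<^bsub>A\<^esub> (g \<otimes>\<^bsub>A\<^esub> inv\<^bsub>A\<^esub> g) \<otimes>\<^bsub>A\<^esub> (y \<otimes>\<^bsub>A\<^esub> g)"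
    using assms by (simp only: conj_act_def A.m_assoc A.m_closed A.inv_closed)
  then show ?thesis using assms by (simp add: conj_act_def A.m_assoc)
qed

lemma conj_act_inj:
  assumes "x \<in> carrier A" "y \<in> carrier A" "g \<in> carrier A"
  shows "conj_act A x g = conj_act A y g \<longleftrightarrow> x = y"
  using assms by (simp add: conj_act_def A.m_assoc)

lemma vtx_el: "v \<in> V \<Longrightarrow> g \<in> W \<Longrightarrow> vtx v g = el (winv g @ (v, True) # g)"
  using el_append[of "winv g" "[(v, True)] @ g"] el_append[of "[(v, True)]" g]
  by (simp add: vtx_def conj_act_def gen_el el_winv A.m_assoc)

lemma vtx_carrier [simp]: "v \<in> V \<Longrightarrow> g \<in> W \<Longrightarrow> vtx v g \<in> carrier A"
  by (simp add: vtx_el)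

lemma vtx_Nil: "v \<in> V \<Longrightarrow> vtx v [] = el [(v, True)]"
  by (simp add: vtx_el)

lemma vtx_append: "v \<in> V \<Longrightarrow> g \<in> W \<Longrightarrow> h \<in> W \<Longrightarrow> vtx v (g @ h) = conj_act A (vtx v g) (el h)"
  by (simp add: vtx_def el_append conj_act_mult gen_el)

lemma vtx_cong: "el g = el h \<Longrightarrow> vtx v g = vtx v h"
  by (simp add: vtx_def)

lemma ext_verts_iff: "x \<in> ext_verts V E \<longleftrightarrow> (\<exists>v g. v \<in> V \<and> g \<in> W \<and> x = vtx v g)"
  by (auto simp: ext_verts_def vtx_def carrier_A)

lemma vtx_in_verts [simp]: "v \<in> V \<Longrightarrow> g \<in> W \<Longrightarrow> vtx v g \<in> ext_verts V E"
  by (auto simp: ext_verts_iff)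

lemma gen_commutes_star_word:
  assumes "s \<in> raag_words (star v)" "v \<in> V"
  shows "el [(v, True)] \<otimes>\<^bsub>A\<^esub> el s = el s \<otimes>\<^bsub>A\<^esub> el [(v, True)]"
  using assms(1)
proof (induction s)
  case Nil
  then show ?case using assms by (simp flip: one_A)
next
  case (Cons y s)
  let ?a = "el [(v, True)]"
  have W: "[y] \<in> W" "s \<in> W" using Cons.prems star_words star_subset by auto
  have "el [y] \<otimes>\<^bsub>A\<^esub> ?a = ?a \<otimes>\<^bsub>A\<^esub> el [y]"
  proof (cases "fst y = v")
    case True
    then have "y = (v, True) \<or> y = (v, False)" by (cases y) auto
    moreover have "el [(v, False)] = inv\<^bsub>A\<^esub> ?a"
      using el_winv[of "[(v, True)]"] assms(2) by simp
    ultimately show ?thesis using assms(2) by auto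
  next
    case False
    then have "(v, fst y) \<in> E" using Cons.prems by (auto simp: star_def)
    then have "el [(v, True), y] = el [y, (v, True)]"
      using el_letters_commute[of "(v, True)" y] by simp
    then show ?thesis using W assms(2) by (simp flip: el_append)
  qed
  then have "?a \<otimes>\<^bsub>A\<^esub> (el [y] \<otimes>\<^bsub>A\<^esub> el s) = el [y] \<otimes>\<^bsub>A\<^esub> (?a \<otimes>\<^bsub>A\<^esub> el s)"
    using W assms(2) by (simp flip: A.m_assoc)
  also have "\<dots> = (el [y] \<otimes>\<^bsub>A\<^esub> el s) \<otimes>\<^bsub>A\<^esub> ?a"
    using Cons W assms(2) by (simp add: A.m_assoc)
  finally show ?case
    using W el_append[of "[y]" s] by simp
qed

lemma vtx_star:
  assumes "v \<in> V" "g \<in> W" "s \<in> raag_words (star v)"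
  shows "vtx v (s @ g) = vtx v g"
proof -
  have s: "s \<in> W" using assms star_words by blast
  have "vtx v s = inv\<^bsub>A\<^esub> (el s) \<otimes>\<^bsub>A\<^esub> (el s \<otimes>\<^bsub>A\<^esub> el [(v, True)])"
    using assms s by (simp add: vtx_def conj_act_def gen_el A.m_assoc gen_commutes_star_word)
  also have "\<dots> = vtx v []"
    using assms s by (simp add: vtx_Nil flip: A.m_assoc)
  finally have "vtx v s = vtx v []" .
  then show ?thesis using assms s vtx_append[of v s g] vtx_append[of v "[]" g] by simp
qed

lemma el_cancel_pair:
  assumes "w = p @ x # q @ flip x # r" "commutes_past E x q" "w \<in> W"
  shows "el w = el (p @ q @ r)"
proof -
  have W: "[x, flip x] \<in> W" "p \<in> W" "q \<in> W" "r \<in> W" using assms by auto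
  have "projections E (q @ flip x # r) = projections E (flip x # q @ r)"
    using assms(2) by (intro projections_move) simp
  from projections_Cons_cong[OF this, of x]
  have "projections E w = projections E (p @ ([x, flip x] @ q @ r))"
    unfolding assms(1) by (intro projections_append_cong[OF HOL.refl]) simp
  then have "el w = el (p @ ([x, flip x] @ q @ r))"
    using assms(1,3) by (intro projections_imp_el) auto
  also have "\<dots> = el (p @ q @ r)"
  proof (rule el_append_cong)
    have "el [x, flip x] = el []"
      using W raag_cong.cancel[of "fst x" V "snd x" E] by (subst el_eq_iff) auto
    then show "el ([x, flip x] @ q @ r) = el (q @ r)"
      using W el_append_cong[of "[x, flip x]" "[]" "q @ r" "q @ r"] by simp
  qed (use W in auto)
  finally show ?thesis .
qed

lemma shorten:
  assumes "w \<in> W" "\<not> cancel_free E w"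
  shows "\<exists>w'\<in>W. el w' = el w \<and> length w' < length w"
proof -
  obtain p x q r where w: "w = p @ x # q @ flip x # r" "commutes_past E x q"
    using assms(2) by (auto simp: cancel_free_def)
  with el_cancel_pair[OF w assms(1)] assms(1) show ?thesis
    by (intro bexI[of _ "p @ q @ r"]) auto
qed

text \<open>
  For a word \<open>g\<close> without cancellations this characterizes the shortest representatives of
  cosets modulo the star subgroup of \<open>v\<close>: no letter of the star can be split off on the left.
\<close>

definition no_star_lead :: "'a \<Rightarrow> ('a \<times> bool) list \<Rightarrow> bool" where
  "no_star_lead v g \<longleftrightarrow> (\<forall>q y r. g = q @ y # r \<and> commutes_past E y q \<longrightarrow> fst y \<notin> star v)"

lemma star_coset_rep:
  assumes "g \<in> W" "v \<in> V"
  obtains s g' where "s \<in> raag_words (star v)" "g' \<in> W" "el g = el (s @ g')"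
    "cancel_free E g'" "no_star_lead v g'"
proof -
  define P where "P = (\<lambda>(s, g'). s \<in> raag_words (star v) \<and> g' \<in> W \<and> el g = el (s @ g'))"
  have "P ([], g)" using assms by (simp add: P_def)
  then obtain z where z: "P z" and zmin: "\<And>y. P y \<Longrightarrow> length (snd z) \<le> length (snd y)"
    using ex_has_least_nat[of P _ "\<lambda>z. length (snd z)"] by blast
  obtain s g' where zz: "z = (s, g')" by force
  have sg: "s \<in> raag_words (star v)" "g' \<in> W" "el g = el (s @ g')"
    using z by (auto simp: P_def zz)
  have s: "s \<in> W" using sg star_words by blast
  have "cancel_free E g'"
  proof (rule ccontr)
    assume "\<not> cancel_free E g'"
    then obtain w where w: "w \<in> W" "el w = el g'" "length w < length g'"
      using shorten sg by blast
    then have "P (s, w)" using sg s by (simp add: P_def el_append)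
    with zmin w show False by (fastforce simp: zz)
  qed
  moreover have "no_star_lead v g'"
    unfolding no_star_lead_def
  proof (intro allI impI notI)
    fix q y r assume y: "g' = q @ y # r \<and> commutes_past E y q" "fst y \<in> star v"
    then have W: "[y] \<in> W" "q \<in> W" "r \<in> W" using sg by auto
    have "el g' = el (y # q @ r)"
      using y sg projections_move by (intro projections_imp_el) auto
    then have "el g' = el [y] \<otimes>\<^bsub>A\<^esub> el (q @ r)"
      using W el_append[of "[y]" "q @ r"] by simp
    then have "el g = el ((s @ [y]) @ (q @ r))"
      using sg s W by (simp only: el_append words_simps) (simp add: A.m_assoc el_append)
    then have "P (s @ [y], q @ r)"
      using sg y W by (simp add: P_def)
    with zmin y show False by (fastforce simp: zz)
  qed
  ultimately show ?thesis using that sg by blast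
qed

lemma cancel_free_append:
  assumes "cancel_free E u" "cancel_free E w"
    and straddle: "\<And>p x q q' r. u = p @ x # q \<Longrightarrow> w = q' @ flip x # r \<Longrightarrow>
      commutes_past E x q \<Longrightarrow> commutes_past E x q' \<Longrightarrow> False"
  shows "cancel_free E (u @ w)"
  unfolding cancel_free_def
proof (intro notI, elim exE conjE)
  have split: "(\<exists>u'. a = p @ x # u' \<and> t = u' @ b) \<or> (\<exists>p'. p = a @ p' \<and> b = p' @ x # t)"
    if "a @ b = p @ x # t" for a b p t :: "('a \<times> bool) list" and x
    using that by (auto simp: append_eq_append_conv2 Cons_eq_append_conv
        append_eq_Cons_conv)
  fix p x q r
  assume e: "u @ w = p @ x # q @ flip x # r" and c: "commutes_past E x q"
  from split[OF e] show False
  proof (elim disjE exE conjE)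
    fix u' assume u: "u = p @ x # u'" and e': "q @ flip x # r = u' @ w"
    from split[OF e'[symmetric]] show False
    proof (elim disjE exE conjE)
      fix u'' assume "u' = q @ flip x # u''"
      with u c assms(1) show False unfolding cancel_free_def by blast
    next
      fix q' assume "q = u' @ q'" "w = q' @ flip x # r"
      with u c straddle[of p x u' q' r] show False by auto
    qed
  next
    fix p' assume "w = p' @ x # q @ flip x # r"
    with c assms(2) show False unfolding cancel_free_def by blast
  qed
qed

lemma cancel_free_winv:
  assumes "cancel_free E g"
  shows "cancel_free E (winv g)"
  unfolding cancel_free_def
proof (intro notI, elim exE conjE)
  fix p x q r assume e: "winv g = p @ x # q @ flip x # r" and c: "commutes_past E x q"
  have "g = winv (p @ x # q @ flip x # r)" by (simp flip: e)
  then have "g = winv r @ x # winv q @ flip x # winv p" by simp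
  moreover have "commutes_past E x (winv q)" using c by (simp add: commutes_past_def set_winv)
  ultimately show False using assms unfolding cancel_free_def by blast
qed

text \<open>
  A cancelling pair would join a letter of the inverse of \<open>g\<close> to \<open>v\<close> or to a letter of \<open>g\<close> across
  \<open>v\<close>. In either case some letter of \<open>g\<close> in the star of \<open>v\<close> could be moved to the front of \<open>g\<close>.
\<close>

lemma cancel_free_conjugate:
  assumes "cancel_free E g" "no_star_lead v g" "v \<in> V"
  shows "cancel_free E (winv g @ (v, True) # g)"
proof (rule cancel_free_append)
  have v: "v \<in> star v" using assms by (simp add: star_def)
  show "cancel_free E (winv g)" using assms cancel_free_winv by blast
  show "cancel_free E ((v, True) # g)"
    using assms(1,2) v by (auto simp: cancel_free_Cons_iff leads_projections_iff no_star_lead_def)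
  fix p x q q' r
  assume e: "winv g = p @ x # q" "(v, True) # g = q' @ flip x # r"
    and c: "commutes_past E x q" "commutes_past E x q'"
  have "g = winv (p @ x # q)" by (simp flip: e(1))
  then have "g = winv q @ flip x # winv p" by simp
  moreover have "commutes_past E (flip x) (winv q)"
    using c(1) by (simp add: commutes_past_def set_winv)
  ultimately have "fst (flip x) \<notin> star v" using assms(2) unfolding no_star_lead_def by blast
  then have x: "fst x \<notin> star v" by simp
  show False
  proof (cases q')
    case Nil
    with e(2) have "fst x = v" by auto
    with x v show False by simp
  next
    case (Cons y q'')
    with e(2) c(2) have "(fst x, v) \<in> E" by auto
    then have "fst x \<in> star v" using E_sym E_verts by (auto simp: star_def)
    with x show False by simp
  qed
qed

text \<open>
  Replacing \<open>g\<close> by a shortest coset representative \<open>g'\<close> does not change \<open>v\<^sup>g\<close> and turns the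
  conjugate into a word without cancellations, so all its letters occur in every other word for
  the same element. Centralizers and commuting conjugates are both read off from this.
\<close>

lemma vtx_letters:
  assumes "v \<in> V" "g \<in> W" "z \<in> W" "vtx v g = el z"
  obtains s g' where "s \<in> raag_words (star v)" "g' \<in> W" "el g = el (s @ g')"
    "set (winv g' @ (v, True) # g') \<subseteq> set z"
proof -
  obtain s g' where g': "s \<in> raag_words (star v)" "g' \<in> W" "el g = el (s @ g')"
    "cancel_free E g'" "no_star_lead v g'"
    using star_coset_rep[OF assms(2,1)] by blast
  let ?c = "winv g' @ (v, True) # g'"
  have "el ?c = el z"
    using assms g' vtx_star[of v g' s] vtx_cong[OF g'(3), of v] by (simp add: vtx_el)
  then have "(?c, z) \<in> raag_cong V E" using assms g' by (subst (asm) el_eq_iff) auto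
  then obtain z' where "subseq z' z" "projections E z' = projections E ?c"
    using cancel_free_subseq[OF cancel_free_conjugate[OF g'(4,5) assms(1)]] by blast
  then have "set ?c \<subseteq> set z" using projections_eq_set set_subseq by metis
  with that g' show ?thesis by blast
qed

text \<open>
  For \<open>u = v\<close> and trivial \<open>h\<close> this is the centralizer theorem: an element commuting with \<open>v\<close>
  is a word in the star of \<open>v\<close>.
\<close>

lemma vtx_eq_iff:
  assumes "v \<in> V" "u \<in> V" "g \<in> W" "h \<in> W" "vtx v g = vtx u h"
  shows "u = v \<and> (\<exists>s\<in>raag_words (star v). el g = el (s @ h))"
proof -
  have "vtx v (g @ winv h) = conj_act A (vtx u h) (el (winv h))"
    using assms by (simp add: vtx_append)
  also have "\<dots> = vtx u (h @ winv h)" using assms by (simp add: vtx_append)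
  also have "\<dots> = vtx u []"
    using assms by (intro vtx_cong) (simp add: el_append el_winv one_A[symmetric])
  finally have eq: "vtx v (g @ winv h) = el [(u, True)]" using assms by (simp add: vtx_Nil)
  obtain s g' where s: "s \<in> raag_words (star v)" "g' \<in> W" "el (g @ winv h) = el (s @ g')"
    "set (winv g' @ (v, True) # g') \<subseteq> set [(u, True)]"
    by (rule vtx_letters[of v "g @ winv h" "[(u, True)]"]) (use assms eq in simp_all)
  have "g' = []"
  proof (rule ccontr)
    assume "g' \<noteq> []"
    then obtain y where "y \<in> set g'" by (cases g') auto
    then have "{y, flip y} \<subseteq> {(u, True)}" using s(4) by (auto simp: set_winv)
    then show False by (cases y) auto
  qed
  have sW: "s \<in> W" using s star_words by blast
  have "el g = el (g @ winv h) \<otimes>\<^bsub>A\<^esub> el h"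
    using assms by (simp add: el_append el_winv A.m_assoc)
  also have "\<dots> = el (s @ h)" using s(3) \<open>g' = []\<close> sW assms by (simp add: el_append)
  finally show ?thesis using s by auto
qed

text \<open>
  Adjacent vertices of the extension graph can be conjugated simultaneously to adjacent vertices
  of \<open>\<Gamma>\<close>. After conjugating back by \<open>c\<close>, the second vertex centralizes \<open>u\<close> and so is a word in the
  star of \<open>u\<close>; by \<open>vtx_letters\<close> its conjugator can be chosen in that star, where it
  fixes \<open>u\<close>.
\<close>

lemma vtx_adjacent:
  assumes "u \<in> V" "v \<in> V" "c \<in> W" "l \<in> W" "(vtx u c, vtx v l) \<in> ext_edges V E"
  shows "(u, v) \<in> E \<and> (\<exists>s\<in>raag_words (star u). vtx v l = vtx v (s @ c))"
proof -
  let ?k = "l @ winv c" and ?a = "el [(u, True)]"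
  let ?y = "vtx v ?k"
  have k: "?k \<in> W" using assms by simp
  have shift: "conj_act A (vtx t g) (el (winv c)) = vtx t (g @ winv c)" if "t \<in> V" "g \<in> W" for t g
    using that assms by (simp add: vtx_append)
  have cc: "vtx t (h @ winv c @ c) = vtx t h" if "t \<in> V" "h \<in> W" for t h
    using that assms by (intro vtx_cong) (simp add: el_append el_winv flip: one_A)
  have ua: "vtx u (c @ winv c) = ?a"
  proof -
    have "vtx u (c @ winv c) = vtx u []"
      using assms by (intro vtx_cong) (simp add: el_append el_winv one_A[symmetric])
    then show ?thesis using assms by (simp add: vtx_Nil)
  qed
  have ne: "vtx u c \<noteq> vtx v l" and comm: "vtx u c \<otimes>\<^bsub>A\<^esub> vtx v l = vtx v l \<otimes>\<^bsub>A\<^esub> vtx u c"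
    using assms(5) by (auto simp: ext_edges_def)
  have "conj_act A (vtx u c) (el (winv c)) \<otimes>\<^bsub>A\<^esub> conj_act A (vtx v l) (el (winv c)) =
      conj_act A (vtx v l) (el (winv c)) \<otimes>\<^bsub>A\<^esub> conj_act A (vtx u c) (el (winv c))"
    using assms comm by (simp add: conj_act_hom)
  then have ya: "?a \<otimes>\<^bsub>A\<^esub> ?y = ?y \<otimes>\<^bsub>A\<^esub> ?a" using assms by (simp add: shift ua)
  let ?z = "winv ?k @ (v, True) # ?k"
  have y: "?y = el ?z" and zW: "?z \<in> W" using assms k by (simp_all add: vtx_el)
  have "vtx u ?z = inv\<^bsub>A\<^esub> ?y \<otimes>\<^bsub>A\<^esub> (?a \<otimes>\<^bsub>A\<^esub> ?y)"
    unfolding vtx_def[of u ?z] gen_el y[symmetric]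
    using assms k by (simp add: conj_act_def A.m_assoc)
  also have "\<dots> = vtx u []"
    using assms k by (simp add: ya vtx_Nil flip: A.m_assoc)
  finally obtain z' where z': "z' \<in> raag_words (star u)" "el ?z = el (z' @ [])"
    using vtx_eq_iff[of u u ?z "[]"] assms zW by auto
  have z'W: "z' \<in> W" using z' star_words by blast
  obtain t k' where t: "t \<in> raag_words (star v)" "k' \<in> W" "el ?k = el (t @ k')"
    "set (winv k' @ (v, True) # k') \<subseteq> set z'"
    by (rule vtx_letters[of v ?k z']) (use y z' z'W k assms in simp_all)
  have k'u: "k' \<in> raag_words (star u)" and vu: "v \<in> star u"
    using t(4) z'(1) by (auto simp: words_iff)
  have yk': "?y = vtx v k'" using vtx_cong[OF t(3)] vtx_star[of v k' t] t assms by simp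
  have vl: "vtx v l = conj_act A ?y (el c)"
    using cc[of v l] assms vtx_append[of v ?k c] by simp
  then have "vtx v l = vtx v (k' @ c)"
    using yk' t assms by (simp add: vtx_append)
  moreover have "u \<noteq> v"
  proof
    assume uv: "u = v"
    then have "?y = vtx v []" using yk' vtx_star[of v "[]" k'] k'u assms by simp
    then have "vtx v l = vtx v c" using vl assms vtx_append[of v "[]" c] by simp
    with ne uv show False by simp
  qed
  ultimately show ?thesis using k'u vu by (auto simp: star_def)
qed

section \<open>Star walks describe paths in the extension graph\<close>

text \<open>
  \<open>star_walk v n u w\<close>: some walk of length \<open>n\<close> in \<open>\<Gamma>\<close> leads from \<open>v\<close> to \<open>u\<close>, and \<open>w\<close> is a
  concatenation of words in the stars of the vertices visited. The factors appear in reverse order,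
  the star of \<open>u\<close> leftmost, since the action is from the right and a word in the star of \<open>u\<close> on the
  left of \<open>w\<close> does not change \<open>u\<^sup>w\<close>.
\<close>

inductive star_walk :: "'a \<Rightarrow> nat \<Rightarrow> 'a \<Rightarrow> ('a \<times> bool) list \<Rightarrow> bool" for v where
  start: "v \<in> V \<Longrightarrow> s \<in> raag_words (star v) \<Longrightarrow> star_walk v 0 v s"
| step: "star_walk v n u w \<Longrightarrow> (u, u') \<in> E \<Longrightarrow> s \<in> raag_words (star u') \<Longrightarrow>
    star_walk v (Suc n) u' (s @ w)"

lemma star_walk_words: "star_walk v n u w \<Longrightarrow> v \<in> V \<and> u \<in> V \<and> w \<in> W"
  by (induction rule: star_walk.induct) (use star_words E_verts in auto)

lemma star_walk_extend:
  assumes "star_walk v n u w" "s \<in> raag_words (star u)"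
  shows "star_walk v n u (s @ w)"
  using assms(1)
proof cases
  case start
  then show ?thesis using assms(2) by (auto intro: star_walk.start)
next
  case (step n' u' w' s')
  then show ?thesis using assms(2) star_walk.step[of v n' u' w' u "s @ s'"] by simp
qed

text \<open>
  The property on which the comparison of translation lengths rests: star words stay star words
  when letters are deleted.
\<close>

lemma star_walk_subseq:
  "star_walk v n u w \<Longrightarrow> subseq w' w \<Longrightarrow> star_walk v n u w'"
proof (induction arbitrary: w' rule: star_walk.induct)
  case (start s)
  then show ?case using words_subseq by (auto intro: star_walk.start)
next
  case (step n u w u' s)
  from step.prems obtain s1 w1 where "w' = s1 @ w1" "subseq s1 s" "subseq w1 w"
    by (auto elim: subseq_appendE)
  then show ?case
    using star_walk.step[OF step.IH step.hyps(2) words_subseq[OF _ step.hyps(3)]] by blast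
qed

lemma ext_edgesI:
  assumes "(u, v) \<in> E" "w \<in> W"
  shows "(vtx u w, vtx v w) \<in> ext_edges V E"
proof -
  have V: "u \<in> V" "v \<in> V" using assms E_verts by auto
  have "el [(v, True)] \<otimes>\<^bsub>A\<^esub> el [(u, True)] = el [(u, True)] \<otimes>\<^bsub>A\<^esub> el [(v, True)]"
    using el_letters_commute[of "(u, True)" "(v, True)"] assms V by (simp flip: el_append)
  then have "vtx u w \<otimes>\<^bsub>A\<^esub> vtx v w = vtx v w \<otimes>\<^bsub>A\<^esub> vtx u w"
    using V assms(2) unfolding vtx_def gen_el by (simp add: conj_act_hom)
  moreover have "vtx u w \<noteq> vtx v w"
    using vtx_eq_iff[of u v w w] V assms by auto
  ultimately show ?thesis
    using V assms by (simp add: ext_edges_def)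
qed

lemma star_walk_path:
  "star_walk v n u w \<Longrightarrow> (vtx v [], vtx u w) \<in> ext_edges V E ^^ n"
proof (induction rule: star_walk.induct)
  case (start s)
  then show ?case using vtx_star[of v "[]" s] by simp
next
  case (step n u w u' s)
  have W: "w \<in> W" "u' \<in> V" using star_walk_words[OF step.hyps(1)] E_verts[OF step.hyps(2)] by auto
  have "vtx u' (s @ w) = vtx u' w" using W step.hyps(3) by (simp add: vtx_star)
  then show ?case using step.IH ext_edgesI[OF step.hyps(2) W(1)] by auto
qed

text \<open>
  Each edge of the path is normalized by \<open>vtx_adjacent\<close>; the element of the star that this
  costs is absorbed into the current star word.
\<close>

lemma path_star_walk:
  assumes "v \<in> V"
  shows "(vtx v [], x) \<in> ext_edges V E ^^ n \<Longrightarrow> \<exists>u w. star_walk v n u w \<and> x = vtx u w"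
proof (induction n arbitrary: x)
  case 0
  then show ?case using assms star_walk.start[of v "[]"] by auto
next
  case (Suc n)
  then obtain y where y: "(vtx v [], y) \<in> ext_edges V E ^^ n" "(y, x) \<in> ext_edges V E"
    by auto
  obtain u w where uw: "star_walk v n u w" "y = vtx u w" using Suc.IH[OF y(1)] by blast
  obtain u' l where u': "u' \<in> V" "l \<in> W" "x = vtx u' l"
    using y(2) by (auto simp: ext_edges_def ext_verts_iff)
  have V: "u \<in> V" "w \<in> W" using star_walk_words[OF uw(1)] by auto
  obtain s where s: "(u, u') \<in> E" "s \<in> raag_words (star u)" "x = vtx u' (s @ w)"
    using vtx_adjacent[of u u' w l] V u' y(2) uw(2) by auto
  have "star_walk v (Suc n) u' ([] @ (s @ w))"
    using star_walk.step[OF star_walk_extend[OF uw(1) s(2)] s(1), of "[]"] by simp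
  with s(3) show ?case by auto
qed

lemma path_iff_star_walk:
  assumes "v \<in> V" "g \<in> W"
  shows "(vtx v [], vtx v g) \<in> ext_edges V E ^^ n \<longleftrightarrow> (\<exists>w. star_walk v n v w \<and> el w = el g)"
proof
  assume "(vtx v [], vtx v g) \<in> ext_edges V E ^^ n"
  then obtain u w where uw: "star_walk v n u w" "vtx v g = vtx u w"
    using path_star_walk[OF assms(1)] by blast
  then have "u = v" and "\<exists>s\<in>raag_words (star v). el g = el (s @ w)"
    using vtx_eq_iff[of v u g w] star_walk_words assms by auto
  then show "\<exists>w. star_walk v n v w \<and> el w = el g"
    using star_walk_extend uw by metis
next
  assume "\<exists>w. star_walk v n v w \<and> el w = el g"
  then show "(vtx v [], vtx v g) \<in> ext_edges V E ^^ n"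
    using star_walk_path vtx_cong by metis
qed

end

section \<open>Translation lengths of isometric actions on connected graphs\<close>

text \<open>
  Fekete's lemma: with \<open>L\<close> the infimum of the quotients and \<open>a k / k\<close> close to \<open>L\<close>, division with
  remainder by \<open>k\<close> bounds \<open>a n / n\<close> by \<open>a k / k + C / n\<close> with a constant \<open>C\<close> independent of \<open>n\<close>.
\<close>

lemma fekete_nonneg:
  fixes a :: "nat \<Rightarrow> real"
  assumes nonneg: "\<And>n. 0 \<le> a n" and subadd: "\<And>m n. a (m + n) \<le> a m + a n"
  shows "\<exists>t. (\<lambda>n. a n / real n) \<longlonglongrightarrow> t"
proof -
  define L where "L = (INF n\<in>{1..}. a n / real n)"
  have bdd: "bdd_below ((\<lambda>n. a n / real n) ` {1..})"
    by (rule bdd_belowI2[of _ 0]) (simp add: nonneg)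
  have lower: "L \<le> a n / real n" if "n \<ge> 1" for n
    unfolding L_def using that by (intro cINF_lower bdd) simp
  have multiple: "a (q * k + r) \<le> real q * a k + a r" for q k r
  proof (induction q)
    case (Suc q)
    have "a (Suc q * k + r) \<le> a k + a (q * k + r)"
      using subadd[of k "q * k + r"] by (simp add: ac_simps)
    with Suc show ?case by (simp add: algebra_simps)
  qed simp
  have "(\<lambda>n. a n / real n) \<longlonglongrightarrow> L"
  proof (rule LIMSEQ_I)
    fix e :: real assume e: "e > 0"
    then have "Inf ((\<lambda>n. a n / real n) ` {1..}) < L + e / 2" unfolding L_def by simp
    then obtain k where k: "k \<ge> 1" "a k / real k < L + e / 2"
      using cInf_lessD[of "(\<lambda>n. a n / real n) ` {1..}"] by auto
    define C where "C = (\<Sum>r<k. a r)"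
    have upper: "a n / real n \<le> a k / real k + C / real n" if n: "n \<ge> 1" for n
    proof -
      have "n mod k < k" using k by simp
      then have "a (n mod k) \<le> C" unfolding C_def by (intro member_le_sum) (auto simp: nonneg)
      then have "a n \<le> real (n div k) * a k + C"
        using multiple[of "n div k" k "n mod k"] by simp
      also have "real (n div k) * a k \<le> (real n / real k) * a k"
        by (intro mult_right_mono nonneg) (rule of_nat_div_le_of_nat)
      finally show ?thesis using n k by (simp add: field_simps)
    qed
    have C0: "C \<ge> 0" unfolding C_def by (simp add: sum_nonneg nonneg)
    obtain N :: nat where N: "real N > 2 * C / e" using reals_Archimedean2 by blast
    have "norm (a n / real n - L) < e" if n: "n \<ge> Suc N" for n
    proof -
      have "C / real n < e / 2"
      proof -
        have "2 * C / e < real n" using N n by linarith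
        then show ?thesis using e n by (simp add: field_simps)
      qed
      moreover have "a n / real n \<le> a k / real k + C / real n" using upper n by simp
      ultimately have "a n / real n < L + e" using k(2) by linarith
      with lower[of n] n show ?thesis by simp
    qed
    then show "\<exists>no. \<forall>n\<ge>no. norm (a n / real n - L) < e" by blast
  qed
  then show ?thesis by blast
qed

locale graph_action = group G for G (structure) +
  fixes X :: "'x set" and R :: "('x \<times> 'x) set" and act :: "'x \<Rightarrow> 'a \<Rightarrow> 'x"
  assumes act_closed: "x \<in> X \<Longrightarrow> g \<in> carrier G \<Longrightarrow> act x g \<in> X"
    and act_one: "x \<in> X \<Longrightarrow> act x \<one> = x"
    and act_mult: "x \<in> X \<Longrightarrow> g \<in> carrier G \<Longrightarrow> h \<in> carrier G \<Longrightarrow> act x (g \<otimes> h) = act (act x g) h"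
    and act_edge: "(x, y) \<in> R \<Longrightarrow> g \<in> carrier G \<Longrightarrow> (act x g, act y g) \<in> R"
    and sym_R: "sym R"
    and connected_R: "x \<in> X \<Longrightarrow> y \<in> X \<Longrightarrow> (x, y) \<in> R\<^sup>*"
    and nonempty: "X \<noteq> {}"
begin

abbreviation "gdist \<equiv> graph_dist R"

lemma dist_path: "x \<in> X \<Longrightarrow> y \<in> X \<Longrightarrow> (x, y) \<in> R ^^ gdist x y"
  unfolding graph_dist_def using rtrancl_imp_relpow[OF connected_R] by (metis LeastI)

lemma dist_le: "(x, y) \<in> R ^^ n \<Longrightarrow> gdist x y \<le> n"
  unfolding graph_dist_def by (rule Least_le)

lemma dist_triangle:
  assumes "x \<in> X" "y \<in> X" "z \<in> X"
  shows "gdist x z \<le> gdist x y + gdist y z"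
proof (rule dist_le)
  show "(x, z) \<in> R ^^ (gdist x y + gdist y z)"
    unfolding relpow_add using dist_path assms by blast
qed

lemma relpow_sym: "(x, y) \<in> R ^^ n \<Longrightarrow> (y, x) \<in> R ^^ n"
proof (induction n arbitrary: y)
  case (Suc n)
  then obtain z where "(x, z) \<in> R ^^ n" "(z, y) \<in> R" by auto
  then have "(z, x) \<in> R ^^ n" "(y, z) \<in> R" using Suc.IH sym_R by (auto dest: symD)
  then show ?case by (meson relpow_Suc_I2)
qed auto

lemma dist_sym: "x \<in> X \<Longrightarrow> y \<in> X \<Longrightarrow> gdist x y = gdist y x"
  using dist_le dist_path relpow_sym by (meson le_antisym)

lemma relpow_act: "(x, y) \<in> R ^^ n \<Longrightarrow> g \<in> carrier G \<Longrightarrow> (act x g, act y g) \<in> R ^^ n"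
proof (induction n arbitrary: y)
  case (Suc n)
  then obtain z where "(x, z) \<in> R ^^ n" "(z, y) \<in> R" by auto
  then have "(act x g, act z g) \<in> R ^^ n" "(act z g, act y g) \<in> R"
    using Suc.IH Suc.prems act_edge by auto
  then show ?case by (meson relpow_Suc_I)
qed auto

lemma dist_act_le:
  "x \<in> X \<Longrightarrow> y \<in> X \<Longrightarrow> g \<in> carrier G \<Longrightarrow> gdist (act x g) (act y g) \<le> gdist x y"
  by (intro dist_le relpow_act dist_path)

lemma dist_act:
  assumes "x \<in> X" "y \<in> X" "g \<in> carrier G"
  shows "gdist (act x g) (act y g) = gdist x y"
proof (rule antisym)
  have "gdist (act (act x g) (inv g)) (act (act y g) (inv g)) \<le> gdist (act x g) (act y g)"
    using assms act_closed by (intro dist_act_le) auto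
  then show "gdist x y \<le> gdist (act x g) (act y g)"
    using assms by (simp add: act_one flip: act_mult)
qed (use assms dist_act_le in auto)

definition transl_length :: "'a \<Rightarrow> real" where
  "transl_length = asymp_transl_length G act X (\<lambda>x y. real (gdist x y))"

lemma displacement_subadditive:
  fixes m n :: nat
  assumes "g \<in> carrier G" "x \<in> X"
  shows "gdist (act x (g [^] (m + n))) x \<le> gdist (act x (g [^] m)) x + gdist (act x (g [^] n)) x"
proof -
  have "act x (g [^] (m + n)) = act (act x (g [^] m)) (g [^] n)"
    using act_mult[of x "g [^] m" "g [^] n"] assms by (simp add: nat_pow_mult)
  then have "gdist (act x (g [^] (m + n))) x \<le>
      gdist (act (act x (g [^] m)) (g [^] n)) (act x (g [^] n)) + gdist (act x (g [^] n)) x"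
    using assms act_closed by (simp add: dist_triangle)
  then show ?thesis using assms act_closed by (simp add: dist_act)
qed

lemma displacement_change_base:
  assumes "h \<in> carrier G" "x \<in> X" "y \<in> X"
  shows "gdist (act y h) y \<le> gdist (act x h) x + 2 * gdist x y"
proof -
  have "gdist (act y h) y \<le> gdist (act y h) (act x h) + gdist (act x h) y"
    using assms act_closed by (intro dist_triangle) auto
  also have "gdist (act x h) y \<le> gdist (act x h) x + gdist x y"
    using assms act_closed by (intro dist_triangle) auto
  finally show ?thesis using assms by (simp add: dist_act dist_sym)
qed

text \<open>
  Displacements are subadditive along powers, so the limit exists at one base point; displacements
  at two base points differ by a bounded amount, so it is the same everywhere and the description
  of the limit in the definition is unambiguous.
\<close>

lemma transl_length_limit:
  assumes g: "g \<in> carrier G" and "x \<in> X"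
  shows "(\<lambda>n. real (gdist (act x (g [^] n)) x) / real n) \<longlonglongrightarrow> transl_length g"
proof -
  let ?a = "\<lambda>x n. real (gdist (act x (g [^] (n::nat))) x)"
  obtain x0 where x0: "x0 \<in> X" using nonempty by blast
  obtain t where t: "(\<lambda>n. ?a x0 n / real n) \<longlonglongrightarrow> t"
    using fekete_nonneg[of "?a x0"] displacement_subadditive[OF g x0]
    by (metis of_nat_0_le_iff of_nat_add of_nat_mono)
  have all: "(\<lambda>n. ?a x n / real n) \<longlonglongrightarrow> t" if x: "x \<in> X" for x
  proof -
    let ?D = "real (2 * gdist x0 x)"
    have "\<bar>?a x n - ?a x0 n\<bar> \<le> ?D" for n
    proof -
      have "gdist (act x (g [^] n)) x \<le> gdist (act x0 (g [^] n)) x0 + 2 * gdist x0 x"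
        using g x x0 by (intro displacement_change_base) auto
      moreover have "gdist (act x0 (g [^] n)) x0 \<le> gdist (act x (g [^] n)) x + 2 * gdist x0 x"
        using displacement_change_base[of "g [^] n" x x0] dist_sym[OF x x0] g x x0 by simp
      ultimately show ?thesis by linarith
    qed
    then have le: "\<forall>n. norm (?a x n / real n - ?a x0 n / real n) \<le> ?D / real n"
      by (simp add: divide_right_mono flip: diff_divide_distrib)
    have "(\<lambda>n. ?a x n / real n - ?a x0 n / real n) \<longlonglongrightarrow> 0"
      by (rule Lim_null_comparison[OF always_eventually[OF le] lim_const_over_n])
    from tendsto_add[OF this t] show ?thesis by simp
  qed
  have "transl_length g = t"
    unfolding transl_length_def asymp_transl_length_def
  proof (rule the_equality)
    show "\<forall>x\<in>X. (\<lambda>n. ?a x n / real n) \<longlonglongrightarrow> t" using all by blast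
    fix t' assume "\<forall>x\<in>X. (\<lambda>n. ?a x n / real n) \<longlonglongrightarrow> t'"
    then have "(\<lambda>n. ?a x0 n / real n) \<longlonglongrightarrow> t'" using x0 by blast
    then show "t' = t" using t by (rule LIMSEQ_unique)
  qed
  with all assms show ?thesis by simp
qed

lemma transl_length_mono:
  assumes "g \<in> carrier G" "h \<in> carrier G" "x \<in> X"
    "\<And>n. gdist (act x (g [^] (n::nat))) x \<le> gdist (act x (h [^] n)) x"
  shows "transl_length g \<le> transl_length h"
  using assms(4)
  by (intro LIMSEQ_le[OF transl_length_limit[OF assms(1,3)] transl_length_limit[OF assms(2,3)]])
    (auto intro!: divide_right_mono)

lemma transl_length_zero:
  assumes "g \<in> carrier G" "x \<in> X" "\<And>n. gdist (act x (g [^] (n::nat))) x \<le> C"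
  shows "transl_length g = 0"
proof -
  have "(\<lambda>n. real (gdist (act x (g [^] (n::nat))) x) / real n) \<longlonglongrightarrow> 0"
    using assms(3)
    by (intro Lim_null_comparison[OF always_eventually lim_const_over_n[of "real C"]])
      (auto intro!: divide_right_mono)
  then show ?thesis using transl_length_limit[OF assms(1,2)] LIMSEQ_unique by blast
qed

lemma pow_conj:
  assumes "g \<in> carrier G" "k \<in> carrier G"
  shows "(inv k \<otimes> g \<otimes> k) [^] (n::nat) = inv k \<otimes> g [^] n \<otimes> k"
proof (induction n)
  case (Suc n)
  have "(inv k \<otimes> g \<otimes> k) [^] Suc n = inv k \<otimes> g [^] n \<otimes> (k \<otimes> inv k) \<otimes> (g \<otimes> k)"
    using assms Suc by (simp only: nat_pow_Suc m_assoc m_closed inv_closed nat_pow_closed)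
  then show ?case using assms by (simp add: m_assoc)
qed (use assms in simp)

lemma transl_length_conj:
  assumes "g \<in> carrier G" "k \<in> carrier G"
  shows "transl_length (inv k \<otimes> g \<otimes> k) = transl_length g"
proof -
  obtain x where x: "x \<in> X" using nonempty by blast
  let ?x = "act x (inv k)"
  have x': "?x \<in> X" using x assms act_closed by simp
  have "gdist (act x ((inv k \<otimes> g \<otimes> k) [^] n)) x = gdist (act ?x (g [^] n)) ?x" for n :: nat
  proof -
    have "act x ((inv k \<otimes> g \<otimes> k) [^] n) = act (act ?x (g [^] n)) k"
      using x assms act_closed by (simp add: pow_conj act_mult)
    moreover have "x = act ?x k" using x assms by (simp add: act_one flip: act_mult)
    ultimately have "gdist (act x ((inv k \<otimes> g \<otimes> k) [^] n)) x = gdist (act (act ?x (g [^] n)) k) (act ?x k)"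
      by simp
    then show ?thesis using x' assms act_closed by (simp add: dist_act)
  qed
  then show ?thesis
    using transl_length_limit[of "inv k \<otimes> g \<otimes> k" x] transl_length_limit[OF assms(1) x']
      assms x LIMSEQ_unique by simp
qed

end

section \<open>Translation lengths on the extension graph\<close>

definition wpow :: "'b list \<Rightarrow> nat \<Rightarrow> 'b list" where
  "wpow w n = concat (replicate n w)"

lemma wpow_simps [simp]: "wpow w 0 = []" "wpow w (Suc n) = w @ wpow w n"
  by (simp_all add: wpow_def)

lemma wpow_add: "wpow w (m + n) = wpow w m @ wpow w n"
  by (induction m) auto

lemma length_wpow [simp]: "length (wpow w n) = n * length w"
  by (induction n) auto

lemma set_wpow: "set (wpow w n) \<subseteq> set w"
  by (induction n) auto

lemma subseq_wpow: "subseq u w \<Longrightarrow> subseq (wpow u n) (wpow w n)"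
  by (induction n) (auto intro: list_emb_append_mono)

lemma nth_wpow: "i < n * length w \<Longrightarrow> wpow w n ! i = w ! (i mod length w)"
proof (induction n arbitrary: i)
  case (Suc n)
  show ?case
  proof (cases "i < length w")
    case False
    then have "(i - length w) mod length w = i mod length w" by (simp add: le_mod_geq)
    with Suc False show ?thesis by (simp add: nth_append)
  qed (simp add: nth_append)
qed simp

context simplicial
begin

lemma words_wpow [simp]:
  fixes U :: "'a set"
  shows "w \<in> raag_words U \<Longrightarrow> wpow w n \<in> raag_words U"
  by (induction n) auto

lemma el_wpow: "w \<in> W \<Longrightarrow> el w [^]\<^bsub>A\<^esub> n = el (wpow w n)"
proof (induction n)
  case (Suc n)
  have "el w [^]\<^bsub>A\<^esub> Suc n = el w \<otimes>\<^bsub>A\<^esub> el w [^]\<^bsub>A\<^esub> n"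
    using Suc.prems A.nat_pow_Suc2 by simp
  then show ?case using Suc by (simp add: el_append)
qed (simp add: one_A)

lemma el_rotate_conj:
  assumes "h \<in> W"
  shows "\<exists>k\<in>carrier A. el (rotate m h) = inv\<^bsub>A\<^esub> k \<otimes>\<^bsub>A\<^esub> el h \<otimes>\<^bsub>A\<^esub> k"
proof (induction m)
  case 0
  then show ?case using assms by (intro bexI[of _ "\<one>\<^bsub>A\<^esub>"]) auto
next
  case (Suc m)
  then obtain k where k: "k \<in> carrier A" "el (rotate m h) = inv\<^bsub>A\<^esub> k \<otimes>\<^bsub>A\<^esub> el h \<otimes>\<^bsub>A\<^esub> k" by blast
  show ?case
  proof (cases "rotate m h")
    case Nil
    then have "rotate (Suc m) h = rotate m h" by simp
    with k show ?thesis by auto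
  next
    case (Cons x t)
    have "rotate m h \<in> W" using assms by (simp add: words_iff)
    then have xt: "[x] \<in> W" "t \<in> W" using Cons by auto
    have "el (rotate (Suc m) h) = el t \<otimes>\<^bsub>A\<^esub> el [x]"
      using xt Cons by (simp add: el_append)
    moreover have "el (rotate m h) = el [x] \<otimes>\<^bsub>A\<^esub> el t"
      using xt Cons el_append[of "[x]" t] by simp
    ultimately have "el (rotate (Suc m) h) = inv\<^bsub>A\<^esub> (el [x]) \<otimes>\<^bsub>A\<^esub> el (rotate m h) \<otimes>\<^bsub>A\<^esub> el [x]"
      using xt by (simp flip: A.m_assoc)
    also have "\<dots> = inv\<^bsub>A\<^esub> (k \<otimes>\<^bsub>A\<^esub> el [x]) \<otimes>\<^bsub>A\<^esub> el h \<otimes>\<^bsub>A\<^esub> (k \<otimes>\<^bsub>A\<^esub> el [x])"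
      using xt k assms by (simp add: A.inv_mult_group A.m_assoc)
    finally show ?thesis using k xt by (intro bexI[of _ "k \<otimes>\<^bsub>A\<^esub> el [x]"]) auto
  qed
qed

definition cyclically_reduced :: "('a \<times> bool) list \<Rightarrow> bool" where
  "cyclically_reduced h \<longleftrightarrow> (\<forall>n. cancel_free E (wpow h n))"

text \<open>
  Let \<open>L\<close> be the length of \<open>h\<close>. A cancelling pair in a power of \<open>h\<close> spans fewer than \<open>L\<close> positions:
  the letter \<open>L\<close> places after its left member \<open>x\<close> is again \<open>x\<close>, which neither commutes
  strictly with \<open>x\<close> nor equals its inverse. So the pair is already visible in a rotation of \<open>h\<close>.
\<close>

lemma cyclically_reduced_if_rotations_cancel_free:
  assumes "\<And>m. cancel_free E (rotate m h)"
  shows "cyclically_reduced h"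
  unfolding cyclically_reduced_def
proof (rule allI, rule ccontr)
  fix n assume "\<not> cancel_free E (wpow h n)"
  then obtain p x q r where w: "wpow h n = p @ x # q @ flip x # r" and c: "commutes_past E x q"
    by (auto simp: cancel_free_def)
  define i where "i = length p"
  define L where "L = length h"
  \<comment> \<open>One more copy of \<open>h\<close> guarantees that a full period follows position \<open>i\<close>.\<close>
  let ?w = "wpow h (n + 1)"
  have w': "?w = p @ x # q @ flip x # r @ h"
    unfolding wpow_add w by simp
  have len: "length ?w = (n + 1) * L" by (simp add: L_def)
  have "n * L = length (wpow h n)" by (simp add: L_def)
  then have i: "i + Suc (length q) < n * L" using w by (simp add: i_def)
  have short: "Suc (length q) < L"
  proof (rule ccontr)
    assume "\<not> Suc (length q) < L"
    then have L: "L \<le> Suc (length q)" by simp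
    have "i + L < (n + 1) * L" "i < (n + 1) * L" using i by simp_all
    then have "?w ! (i + L) = ?w ! i"
      using nth_wpow[of "i + L" "n + 1" h] nth_wpow[of i "n + 1" h] by (simp add: L_def)
    also have "?w ! i = x" unfolding w' i_def by simp
    finally have x: "?w ! (i + L) = x" .
    have L0: "L > 0" using i by (cases L) auto
    show False
    proof (cases "L = Suc (length q)")
      case True
      then have "?w ! (i + L) = flip x" unfolding w' i_def by (simp add: nth_append)
      with x show False by (metis snd_conv)
    next
      case False
      with L L0 have "L - 1 < length q" by simp
      moreover have "?w ! (i + L) = q ! (L - 1)"
        using \<open>L - 1 < length q\<close> L0 unfolding w' i_def by (simp add: nth_append nth_Cons')
      ultimately have "x \<in> set q" using x by (metis nth_mem)
      with c show False by (auto simp: commutes_past_def)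
    qed
  qed
  have "rotate i h = take L (drop i ?w)"
  proof (rule nth_equalityI)
    show lens: "length (rotate i h) = length (take L (drop i ?w))"
      using i len by (simp add: L_def)
    fix j assume "j < length (rotate i h)"
    then have j: "j < L" by (simp add: L_def)
    then have "rotate i h ! j = h ! ((i + j) mod L)" by (simp add: nth_rotate L_def add.commute)
    moreover have "take L (drop i ?w) ! j = h ! ((i + j) mod L)"
    proof -
      have b: "i + j < (n + 1) * length h" "i \<le> length ?w" using i j len by (simp_all add: L_def)
      show ?thesis
        using nth_take[OF j, of "drop i ?w"] nth_drop[OF b(2), of j] nth_wpow[OF b(1)]
        by (simp only: L_def)
    qed
    ultimately show "rotate i h ! j = take L (drop i ?w) ! j" by simp
  qed
  also have "\<dots> = [] @ x # q @ flip x # take (L - Suc (Suc (length q))) (r @ h)"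
    unfolding w' i_def using short by (cases L) (auto simp: take_Cons' take_all)
  finally have "\<not> cancel_free E (rotate i h)" using c unfolding cancel_free_def by blast
  with assms show False by blast
qed

text \<open>
  Take \<open>h\<close> of minimal length among the words that represent a conjugate of \<open>x\<close>; rotations of \<open>h\<close>
  are conjugate to \<open>h\<close> and of the same length, so they admit no cancellation.
\<close>

lemma conj_cyclically_reduced:
  assumes "x \<in> carrier A"
  obtains h k where "h \<in> W" "k \<in> carrier A" "x = inv\<^bsub>A\<^esub> k \<otimes>\<^bsub>A\<^esub> el h \<otimes>\<^bsub>A\<^esub> k" "cyclically_reduced h"
proof -
  define P where "P h \<longleftrightarrow> h \<in> W \<and> (\<exists>k\<in>carrier A. x = inv\<^bsub>A\<^esub> k \<otimes>\<^bsub>A\<^esub> el h \<otimes>\<^bsub>A\<^esub> k)" for h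
  obtain w where "w \<in> W" "x = el w" using assms by (auto simp: carrier_A)
  then have "P w" unfolding P_def by (auto intro!: bexI[of _ "\<one>\<^bsub>A\<^esub>"])
  then obtain h where h: "P h" and hmin: "\<And>y. P y \<Longrightarrow> length h \<le> length y"
    using ex_has_least_nat[of P w length] by blast
  obtain k where k: "k \<in> carrier A" "x = inv\<^bsub>A\<^esub> k \<otimes>\<^bsub>A\<^esub> el h \<otimes>\<^bsub>A\<^esub> k" and hW: "h \<in> W"
    using h by (auto simp: P_def)
  have "cancel_free E (rotate m h)" for m
  proof (rule ccontr)
    assume n: "\<not> cancel_free E (rotate m h)"
    have "rotate m h \<in> W" using hW by (simp add: words_iff)
    then obtain w where w: "w \<in> W" "el w = el (rotate m h)" "length w < length h"
      using shorten n by fastforce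
    obtain l where l: "l \<in> carrier A" "el w = inv\<^bsub>A\<^esub> l \<otimes>\<^bsub>A\<^esub> el h \<otimes>\<^bsub>A\<^esub> l"
      using el_rotate_conj[OF hW, of m] w(2) by auto
    have "inv\<^bsub>A\<^esub> (inv\<^bsub>A\<^esub> l \<otimes>\<^bsub>A\<^esub> k) \<otimes>\<^bsub>A\<^esub> el w \<otimes>\<^bsub>A\<^esub> (inv\<^bsub>A\<^esub> l \<otimes>\<^bsub>A\<^esub> k) =
        inv\<^bsub>A\<^esub> k \<otimes>\<^bsub>A\<^esub> (l \<otimes>\<^bsub>A\<^esub> inv\<^bsub>A\<^esub> l) \<otimes>\<^bsub>A\<^esub> el h \<otimes>\<^bsub>A\<^esub> (l \<otimes>\<^bsub>A\<^esub> inv\<^bsub>A\<^esub> l) \<otimes>\<^bsub>A\<^esub> k"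
      using k(1) l hW by (simp only: A.inv_mult_group A.inv_inv A.m_assoc A.m_closed A.inv_closed el_carrier)
    also have "\<dots> = x" using k l hW by simp
    finally have "P w" using w k l unfolding P_def by (metis A.inv_closed A.m_closed)
    with hmin w show False by fastforce
  qed
  then have "cyclically_reduced h" by (rule cyclically_reduced_if_rotations_cancel_free)
  with that k hW show ?thesis by blast
qed

lemma star_walk_move:
  assumes "star_walk v n u w" "(u, u') \<in> E\<^sup>*"
  shows "\<exists>n'. star_walk v n' u' w"
  using assms(2)
proof induction
  case (step y z)
  then obtain n' where "star_walk v n' y w" by blast
  then have "star_walk v (Suc n') z ([] @ w)" using step by (intro star_walk.step) auto
  then show ?case by auto
qed (use assms in blast)

end

locale connected_simplicial = simplicial +
  assumes connected: "graph_connected V E" and V_nonempty: "V \<noteq> {}"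
begin

lemma star_walk_exists:
  "v \<in> V \<Longrightarrow> u \<in> V \<Longrightarrow> w \<in> W \<Longrightarrow> \<exists>n. star_walk v n u w"
proof (induction w arbitrary: u)
  case Nil
  then have "star_walk v 0 v []" "(v, u) \<in> E\<^sup>*"
    using connected by (auto intro: star_walk.start simp: graph_connected_def)
  then show ?case by (rule star_walk_move)
next
  case (Cons x w)
  then obtain n where "star_walk v n (fst x) w" by fastforce
  then have "star_walk v n (fst x) ([x] @ w)"
    using Cons.prems by (intro star_walk_extend) (auto simp: star_def)
  moreover have "(fst x, u) \<in> E\<^sup>*"
    using connected Cons.prems by (auto simp: graph_connected_def)
  ultimately show ?case using star_walk_move by fastforce
qed

lemma sym_ext_edges: "sym (ext_edges V E)"
  by (auto simp: sym_def ext_edges_def)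

sublocale ext: graph_action A "ext_verts V E" "ext_edges V E" "conj_act A"
proof
  fix x g assume "x \<in> ext_verts V E" "g \<in> carrier A"
  then show "conj_act A x g \<in> ext_verts V E"
    by (auto simp: ext_verts_iff carrier_A) (metis vtx_append words_simps(3))
next
  fix x assume "x \<in> ext_verts V E"
  then show "conj_act A x \<one>\<^bsub>A\<^esub> = x" by (auto simp: ext_verts_iff conj_act_one)
next
  fix x g h assume "x \<in> ext_verts V E" "g \<in> carrier A" "h \<in> carrier A"
  then show "conj_act A x (g \<otimes>\<^bsub>A\<^esub> h) = conj_act A (conj_act A x g) h"
    by (intro conj_act_mult) (auto simp: ext_verts_iff)
next
  fix x y g assume xy: "(x, y) \<in> ext_edges V E" and g: "g \<in> carrier A"
  then have c: "x \<in> carrier A" "y \<in> carrier A" by (auto simp: ext_edges_def ext_verts_iff)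
  have "conj_act A z g \<in> ext_verts V E" if "z \<in> ext_verts V E" for z
    using that g by (auto simp: ext_verts_iff carrier_A) (metis vtx_append words_simps(3))
  then show "(conj_act A x g, conj_act A y g) \<in> ext_edges V E"
    using xy c g by (auto simp: ext_edges_def conj_act_inj conj_act_hom)
next
  show "sym (ext_edges V E)" by (rule sym_ext_edges)
next
  fix x y assume "x \<in> ext_verts V E" "y \<in> ext_verts V E"
  then obtain v g u h where v: "v \<in> V" "g \<in> W" "x = vtx v g" and u: "u \<in> V" "h \<in> W" "y = vtx u h"
    by (auto simp: ext_verts_iff)
  have "(vtx v [], vtx t w) \<in> (ext_edges V E)\<^sup>*" if "t \<in> V" "w \<in> W" for t w
    using star_walk_exists[OF v(1) that] star_walk_path relpow_imp_rtrancl by blast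
  then have "(vtx v [], x) \<in> (ext_edges V E)\<^sup>*" "(vtx v [], y) \<in> (ext_edges V E)\<^sup>*"
    using u v by auto
  from rtrancl_trans[OF symD[OF sym_rtrancl[OF sym_ext_edges] this(1)] this(2)]
  show "(x, y) \<in> (ext_edges V E)\<^sup>*" .
next
  show "ext_verts V E \<noteq> {}" using V_nonempty vtx_in_verts[OF _ words_simps(1)] by blast
qed

lemma transl_length_ext:
  "asymp_transl_length A (conj_act A) (ext_verts V E) (ext_dist V E) = ext.transl_length"
  by (simp add: ext.transl_length_def ext_dist_def[abs_def])

definition displacement :: "'a \<Rightarrow> ('a \<times> bool) list \<Rightarrow> nat" where
  "displacement v w = graph_dist (ext_edges V E) (vtx v []) (vtx v w)"

lemma displacement_le: "star_walk v n v w \<Longrightarrow> displacement v w \<le> n"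
  unfolding displacement_def by (intro ext.dist_le star_walk_path)

lemma displacement_star_walk:
  assumes "v \<in> V" "w \<in> W"
  shows "\<exists>s. star_walk v (displacement v w) v s \<and> el s = el w"
  using ext.dist_path[of "vtx v []" "vtx v w"] path_iff_star_walk[OF assms] assms
  by (simp add: displacement_def)

lemma displacement_cong: "el u = el w \<Longrightarrow> displacement v u = displacement v w"
  unfolding displacement_def by (drule vtx_cong[of u w v]) simp

lemma displacement_pow:
  assumes "v \<in> V" "w \<in> W"
  shows "graph_dist (ext_edges V E) (conj_act A (vtx v []) (el w [^]\<^bsub>A\<^esub> n)) (vtx v []) =
    displacement v (wpow w n)"
proof -
  have "conj_act A (vtx v []) (el w [^]\<^bsub>A\<^esub> n) = vtx v (wpow w n)"
    using assms vtx_append[of v "[]" "wpow w n"] by (simp add: el_wpow)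
  then show ?thesis using assms ext.dist_sym[of "vtx v []"] by (simp add: displacement_def)
qed

lemma displacement_limit:
  assumes "v \<in> V" "w \<in> W"
  shows "(\<lambda>n. real (displacement v (wpow w n)) / real n) \<longlonglongrightarrow> ext.transl_length (el w)"
  using ext.transl_length_limit[of "el w" "vtx v []"] assms by (simp add: displacement_pow)

lemma transl_length_bounded_zero:
  assumes "v \<in> V" "w \<in> W" "\<And>n. displacement v (wpow w n) \<le> C"
  shows "ext.transl_length (el w) = 0"
  using assms by (intro ext.transl_length_zero[of _ "vtx v []" C]) (auto simp: displacement_pow)

text \<open>
  A shortest factorization of \<open>h\<^sup>n\<close> into star words contains the letters of \<open>h\<^sup>n\<close>, because no
  letters of \<open>h\<^sup>n\<close> cancel. Deleting those outside \<open>g\<^sup>n\<close> leaves a factorization of \<open>g\<^sup>n\<close> along the same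
  walk.
\<close>

lemma transl_length_subseq_le:
  assumes "h \<in> W" "cyclically_reduced h" "subseq g h"
  shows "ext.transl_length (el g) \<le> ext.transl_length (el h)"
proof -
  obtain v where v: "v \<in> V" using V_nonempty by blast
  have g: "g \<in> W" using assms words_subseq by blast
  have "displacement v (wpow g n) \<le> displacement v (wpow h n)" for n
  proof -
    obtain s where s: "star_walk v (displacement v (wpow h n)) v s" "el s = el (wpow h n)"
      using displacement_star_walk[OF v, of "wpow h n"] assms by auto
    have sW: "s \<in> W" using star_walk_words[OF s(1)] by blast
    have "(wpow h n, s) \<in> raag_cong V E"
      using s(2) sW assms(1) by (subst el_eq_iff[symmetric]) auto
    then obtain s' where s': "subseq s' s" "projections E s' = projections E (wpow g n)"
      using subseq_of_cancel_free subseq_wpow[OF assms(3)] assms(2)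
      unfolding cyclically_reduced_def by blast
    have "el s' = el (wpow g n)"
      using s' sW g words_subseq by (intro projections_imp_el) auto
    then show ?thesis
      using displacement_le[OF star_walk_subseq[OF s(1) s'(1)]] displacement_cong by metis
  qed
  then show ?thesis
    using v g assms(1) by (intro ext.transl_length_mono[of _ _ "vtx v []"]) (auto simp: displacement_pow)
qed

section \<open>Which elements have positive translation length\<close>

lemma transl_length_star_zero:
  assumes "v \<in> V" "h \<in> raag_words (star v)"
  shows "ext.transl_length (el h) = 0"
proof -
  have "displacement v (wpow h n) \<le> 0" for n
    using assms by (intro displacement_le star_walk.start) auto
  then show ?thesis using assms star_words by (intro transl_length_bounded_zero[of v _ 0]) auto
qed

lemma projections_join:
  assumes "fst ` set w \<subseteq> B \<union> C" "B \<times> C \<subseteq> E"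
  shows "projections E (filter (\<lambda>x. fst x \<in> B) w @ filter (\<lambda>x. fst x \<notin> B) w) = projections E w"
  using assms(1)
proof (induction w)
  case (Cons x w)
  let ?B = "filter (\<lambda>x. fst x \<in> B) w" and ?C = "filter (\<lambda>x. fst x \<notin> B) w"
  have IH: "projections E (x # ?B @ ?C) = projections E (x # w)"
    using Cons by (intro projections_Cons_cong) auto
  show ?case
  proof (cases "fst x \<in> B")
    case False
    then have "commutes_past E x ?B"
      using Cons.prems assms(2) E_sym by (auto simp: commutes_past_def)
    from projections_move[OF this] IH False show ?thesis by simp
  qed (use IH in simp)
qed simp

text \<open>
  The powers of \<open>h\<close> split into a part over \<open>B\<close>, which lies in the star of \<open>c\<close>, and a part over \<open>C\<close>,
  which lies in the star of \<open>b\<close>; the closed walk \<open>b, c, b\<close> then suffices for all of them.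
\<close>

lemma transl_length_join_zero:
  assumes "h \<in> W" "fst ` set h \<subseteq> B \<union> C" "B \<times> C \<subseteq> E" "b \<in> B" "c \<in> C"
  shows "ext.transl_length (el h) = 0"
proof -
  have bc: "(b, c) \<in> E" using assms by auto
  then have V: "b \<in> V" "c \<in> V" using E_verts by auto
  have "displacement b (wpow h n) \<le> 2" for n
  proof -
    let ?w = "wpow h n"
    let ?B = "filter (\<lambda>x. fst x \<in> B) ?w" and ?C = "filter (\<lambda>x. fst x \<notin> B) ?w"
    have wW: "?w \<in> W" using assms by simp
    have supp: "fst ` set ?w \<subseteq> B \<union> C" using assms set_wpow by fastforce
    have "x \<in> star c" if "x \<in> B" for x
    proof -
      have "(x, c) \<in> E" using that assms(3,5) by blast
      then show ?thesis using E_sym[of x c] E_verts[of x c] by (simp add: star_def)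
    qed
    then have "?B \<in> raag_words (star c)" by (auto simp: words_iff)
    moreover have "x \<in> star b" if "x \<in> C" for x
    proof -
      have "(b, x) \<in> E" using that assms(3,4) by blast
      then show ?thesis using E_verts[of b x] by (simp add: star_def)
    qed
    then have "?C \<in> raag_words (star b)" using supp by (auto simp: words_iff)
    ultimately have "star_walk b (Suc 0) c (?B @ ?C)"
      using star_walk.step[OF star_walk.start[OF V(1)] bc] by blast
    from star_walk.step[OF this E_sym[OF bc], of "[]"]
    have "star_walk b (Suc (Suc 0)) b (?B @ ?C)" by simp
    moreover have "?B @ ?C \<in> W" using wW by (auto simp: words_iff)
    then have "el (?B @ ?C) = el ?w"
      using wW projections_join[OF supp assms(3)] by (intro projections_imp_el)
    ultimately show ?thesis
      using displacement_le[of b "Suc (Suc 0)" "?B @ ?C"] displacement_cong[of "?B @ ?C" ?w b]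
      by simp
  qed
  then show ?thesis using assms V by (intro transl_length_bounded_zero[of b _ 2]) auto
qed

text \<open>
  The supports of cyclically reduced words with positive translation length: neither contained in
  a star nor the vertex set of a join.
\<close>

definition spread :: "'a set \<Rightarrow> bool" where
  "spread U \<longleftrightarrow> U \<noteq> {} \<and> graph_connected U (complement_edges U E) \<and> (\<forall>v\<in>V. \<not> U \<subseteq> star v)"

text \<open>
  If the complement graph on the support is disconnected, a component and the rest of the support
  form a join.
\<close>

lemma spread_if_transl_length_pos:
  assumes "h \<in> W" "ext.transl_length (el h) > 0"
  shows "spread (fst ` set h)"
proof -
  let ?U = "fst ` set h"
  have not_star: "\<not> ?U \<subseteq> star v" if "v \<in> V" for v
    using that assms transl_length_star_zero by (fastforce simp: words_iff)
  have "?U \<noteq> {}" using not_star V_nonempty by fastforce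
  moreover have "(a, b) \<in> (complement_edges ?U E)\<^sup>*" if ab: "a \<in> ?U" "b \<in> ?U" for a b
  proof (rule ccontr)
    assume n: "(a, b) \<notin> (complement_edges ?U E)\<^sup>*"
    define B where "B = {x \<in> ?U. (a, x) \<in> (complement_edges ?U E)\<^sup>*}"
    have "(x, y) \<in> E" if "x \<in> B" "y \<in> ?U - B" for x y
    proof (rule ccontr)
      assume "(x, y) \<notin> E"
      with that have "(x, y) \<in> complement_edges ?U E" by (auto simp: B_def complement_edges_def)
      with that show False by (auto simp: B_def intro: rtrancl.rtrancl_into_rtrancl)
    qed
    then have "ext.transl_length (el h) = 0"
      using ab n assms(1) by (intro transl_length_join_zero[of h B "?U - B" a b]) (auto simp: B_def)
    with assms show False by simp
  qed
  ultimately show ?thesis using not_star by (simp add: spread_def graph_connected_def)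
qed

definition occ :: "'a \<Rightarrow> ('a \<times> bool) list \<Rightarrow> nat" where
  "occ a w = length (filter (\<lambda>x. fst x = a) w)"

lemma occ_simps [simp]:
  "occ a [] = 0" "occ a (x # w) = (if fst x = a then 1 else 0) + occ a w"
  "occ a (u @ w) = occ a u + occ a w"
  by (auto simp: occ_def)

lemma occ_zero: "a \<notin> fst ` set w \<Longrightarrow> occ a w = 0"
  by (auto simp: occ_def filter_empty_conv)

lemma occ_distinct: "distinct (map fst w) \<Longrightarrow> occ a w = (if a \<in> fst ` set w then 1 else 0)"
  by (induction w) (auto simp: occ_zero)

lemma occ_suffix_le: "suffix t w \<Longrightarrow> occ a t \<le> occ a w"
  by (auto simp: suffix_def)

lemma occ_wpow: "occ a (wpow w n) = n * occ a w"
  by (induction n) auto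

lemma suffix_filter_exists:
  "suffix u (filter P w) \<Longrightarrow> \<exists>t. suffix t w \<and> filter P t = u"
proof (induction w)
  case (Cons x w)
  show ?case
  proof (cases "suffix u (filter P w)")
    case True
    with Cons.IH show ?thesis by (meson suffix_ConsI)
  next
    case False
    with Cons.prems have "u = filter P (x # w)" by (auto simp: suffix_Cons split: if_splits)
    then show ?thesis by blast
  qed
qed auto

text \<open>
  A suffix of a power consists of full copies of \<open>g\<close> and a suffix of \<open>g\<close>, in which every vertex
  occurs at most once.
\<close>

lemma occ_suffix_wpow:
  assumes "distinct (map fst g)" "a \<in> fst ` set g" "b \<in> fst ` set g" "suffix t (wpow g m)"
  shows "occ a t \<le> occ b t + 1"
  using assms(4)
proof (induction m)
  case (Suc m)
  then consider "suffix t (wpow g m)" | t' where "t = t' @ wpow g m" "suffix t' g"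
    by (auto simp: suffix_append)
  then show ?case
  proof cases
    case 2
    have "occ a t' \<le> 1" using occ_suffix_le[OF 2(2), of a] assms by (simp add: occ_distinct)
    then show ?thesis using 2 assms by (simp add: occ_wpow occ_distinct)
  qed (use Suc in blast)
qed simp

text \<open>
  For non-adjacent \<open>a\<close> and \<open>b\<close> the counts can be read off from the projection to this pair, which
  \<open>s\<close> shares with the power of \<open>g\<close>.
\<close>

lemma occ_balanced:
  assumes g: "distinct (map fst g)" and s: "projections E s = projections E (wpow g m)"
    and t: "suffix t s" and ab: "(a, b) \<in> complement_edges (fst ` set g) E"
  shows "occ a t \<le> occ b t + 1"
proof -
  let ?P = "\<lambda>x. fst x = a \<or> fst x = b"
  have "filter ?P s = filter ?P (wpow g m)"
    using fun_cong[OF fun_cong[OF s, of a], of b] ab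
    by (auto simp: projections_def complement_edges_def)
  moreover have "suffix (filter ?P t) (filter ?P s)"
    using t by (auto simp: suffix_def)
  ultimately have "suffix (filter ?P t) (filter ?P (wpow g m))" by simp
  then obtain t' where t': "suffix t' (wpow g m)" "filter ?P t' = filter ?P t"
    using suffix_filter_exists by blast
  have "occ c t = occ c t'" if "c = a \<or> c = b" for c
  proof -
    have *: "(\<lambda>x. ?P x \<and> fst x = c) = (\<lambda>x. fst x = c)" using that by auto
    have "occ c u = length (filter (\<lambda>x. fst x = c) (filter ?P u))" for u
      by (simp only: occ_def filter_filter *)
    from this[of t] this[of t'] show ?thesis unfolding t'(2) by simp
  qed
  then show ?thesis
    using occ_suffix_wpow[OF g _ _ t'(1), of a b] ab by (auto simp: complement_edges_def)
qed

text \<open>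
  The star word added in a step misses some \<open>b \<in> U\<close>. So the count of \<open>b\<close> does not grow, and
  all other counts exceed it by at most \<open>K\<close>.
\<close>

lemma occ_star_walk_bound:
  assumes "star_walk v n u w"
    and U: "\<And>v. v \<in> V \<Longrightarrow> \<not> U \<subseteq> star v"
    and K: "\<And>t a b. suffix t w \<Longrightarrow> a \<in> U \<Longrightarrow> b \<in> U \<Longrightarrow> occ a t \<le> occ b t + K"
    and "a \<in> U"
  shows "occ a w \<le> (n + 1) * K"
  using assms(1) K assms(4)
proof (induction arbitrary: a rule: star_walk.induct)
  case (start s)
  then obtain b where b: "b \<in> U" "b \<notin> star v" using U by blast
  then have "occ b s = 0" using start by (intro occ_zero) (auto simp: words_iff)
  then show ?case using start.prems(1)[of s a b] start.prems b by simp
next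
  case (step n u w u' s)
  have "u' \<in> V" using step.hyps E_verts by blast
  then obtain b where b: "b \<in> U" "b \<notin> star u'" using U by blast
  then have "occ b s = 0" using step by (intro occ_zero) (auto simp: words_iff)
  moreover have "occ b w \<le> (n + 1) * K"
    using step.IH[OF step.prems(1)] b by (auto intro: suffix_appendI)
  ultimately show ?case using step.prems(1)[of "s @ w" a b] step.prems b by simp
qed

lemma cyclically_reduced_if_distinct:
  assumes "distinct (map fst g)"
  shows "cyclically_reduced g"
  unfolding cyclically_reduced_def cancel_free_def
proof (intro allI notI, elim exE conjE)
  fix n p x q r assume "wpow g n = p @ x # q @ flip x # r"
  then have "x \<in> set (wpow g n)" "flip x \<in> set (wpow g n)" by auto
  then have "x \<in> set g" "flip x \<in> set g" using subsetD[OF set_wpow[of g n]] by simp_all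
  moreover have "inj_on fst (set g)" using assms by (simp add: distinct_map)
  ultimately have "x = flip x" using inj_onD[of fst "set g" x "flip x"] by simp
  then show False by (metis snd_conv)
qed

text \<open>
  Along paths in the complement graph on the support, the balance between non-adjacent vertices
  extends to all pairs of vertices of the support, with discrepancy at most \<open>K\<close>, the diameter of
  that graph. Then \<open>n\<close> steps account for at most \<open>(n + 1) * K\<close> copies of \<open>g\<close>, and the translation
  length is at least \<open>1 / K\<close>.
\<close>

lemma transl_length_pos:
  assumes g: "g \<in> W" "distinct (map fst g)" and spread: "spread (fst ` set g)"
  shows "ext.transl_length (el g) > 0"
proof -
  let ?U = "fst ` set g" and ?R = "complement_edges (fst ` set g) E"
  obtain v where v: "v \<in> V" using V_nonempty by blast
  define a where "a = fst (hd g)"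
  have "g \<noteq> []" using spread by (auto simp: spread_def)
  then have a: "a \<in> ?U" by (simp add: a_def)
  define K where "K = Max ((\<lambda>(a, b). graph_dist ?R a b) ` (?U \<times> ?U))"
  have steps: "occ a t \<le> occ b t + n"
    if "(a, b) \<in> ?R ^^ n" "suffix t s" "projections E s = projections E (wpow g m)" for a b t s n m
    using that(1)
  proof (induction n arbitrary: b)
    case (Suc n)
    then obtain c where "(a, c) \<in> ?R ^^ n" "(c, b) \<in> ?R" by auto
    then show ?case using Suc.IH[of c] occ_balanced[OF g(2) that(3,2), of c b] by linarith
  qed simp
  have K: "occ a t \<le> occ b t + K"
    if "a \<in> ?U" "b \<in> ?U" "suffix t s" "projections E s = projections E (wpow g m)" for a b t s m
  proof -
    have "(a, b) \<in> ?R\<^sup>*" using spread that by (auto simp: spread_def graph_connected_def)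
    then have "(a, b) \<in> ?R ^^ graph_dist ?R a b"
      unfolding graph_dist_def using rtrancl_imp_relpow by (metis LeastI)
    moreover have "graph_dist ?R a b \<le> K"
      unfolding K_def using that by (intro Max_ge) auto
    ultimately show ?thesis using steps[OF _ that(3,4)] by fastforce
  qed
  have bound: "m \<le> (displacement v (wpow g m) + 1) * K" for m
  proof -
    obtain s where s: "star_walk v (displacement v (wpow g m)) v s" "el s = el (wpow g m)"
      using displacement_star_walk[OF v, of "wpow g m"] g by auto
    have "s \<in> W" using star_walk_words[OF s(1)] by blast
    then have "(wpow g m, s) \<in> raag_cong V E"
      using s(2) g by (subst el_eq_iff[symmetric]) auto
    then obtain s' where s': "subseq s' s" "projections E s' = projections E (wpow g m)"
      using cancel_free_subseq cyclically_reduced_if_distinct[OF g(2)]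
      unfolding cyclically_reduced_def by blast
    have "m = occ a (wpow g m)" using g a by (simp add: occ_wpow occ_distinct)
    also have "\<dots> = occ a s'"
      using fun_cong[OF fun_cong[OF s'(2), of a], of a] by (simp add: projections_def occ_def)
    also have "\<dots> \<le> (displacement v (wpow g m) + 1) * K"
      using spread K[OF _ _ _ s'(2)] a
      by (intro occ_star_walk_bound[OF star_walk_subseq[OF s(1) s'(1)], of ?U]) (auto simp: spread_def)
    finally show ?thesis .
  qed
  have "K > 0" using bound[of 1] by (cases K) auto
  have "(\<lambda>m. real (displacement v (wpow g m)) / real m + 1 / real m) \<longlonglongrightarrow> ext.transl_length (el g) + 0"
    by (intro tendsto_add displacement_limit v g lim_const_over_n)
  moreover have "1 / real K \<le> real (displacement v (wpow g m)) / real m + 1 / real m" if "m \<ge> 1" for m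
  proof -
    have "real m \<le> (real (displacement v (wpow g m)) + 1) * real K"
      using of_nat_mono[OF bound[of m], where 'a = real] by (simp add: algebra_simps)
    then show ?thesis using that \<open>K > 0\<close> by (simp add: field_simps)
  qed
  ultimately have "1 / real K \<le> ext.transl_length (el g) + 0"
    by (intro LIMSEQ_le_const) blast+
  then show ?thesis using \<open>K > 0\<close> by (smt (verit) divide_pos_pos of_nat_0_less_iff)
qed

end

context connected_simplicial
begin

section \<open>The minimum is attained\<close>

lemma transversal_exists: "\<exists>g. subseq g h \<and> distinct (map fst g) \<and> fst ` set g = fst ` set h"
proof (induction h)
  case (Cons x h)
  then obtain g where g: "subseq g h" "distinct (map fst g)" "fst ` set g = fst ` set h" by blast
  show ?case
  proof (cases "fst x \<in> fst ` set g")
    case True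
    then show ?thesis using g by (intro exI[of _ g]) auto
  next
    case False
    then show ?thesis using g by (intro exI[of _ "x # g"]) auto
  qed
qed simp

text \<open>
  The candidates for the minimum: positive translation lengths of words in which no vertex is
  repeated, not even with opposite signs.
\<close>

definition transversal_lengths :: "real set" where
  "transversal_lengths =
    {ext.transl_length (el g) | g. g \<in> W \<and> distinct (map fst g) \<and> ext.transl_length (el g) > 0}"

lemma transversal_lengthsI:
  assumes "g \<in> W" "distinct (map fst g)" "ext.transl_length (el g) > 0"
  shows "ext.transl_length (el g) \<in> transversal_lengths"
  unfolding transversal_lengths_def mem_Collect_eq using assms by (intro exI[of _ g]) simp

lemma finite_transversal_lengths:
  assumes "finite V"
  shows "finite transversal_lengths"
proof -
  have "length g \<le> card V" if "g \<in> W" "distinct (map fst g)" for g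
  proof -
    have "length g = card (fst ` set g)" using distinct_card[OF that(2)] by simp
    also have "\<dots> \<le> card V" using that assms by (intro card_mono) (auto simp: words_iff)
    finally show ?thesis .
  qed
  then have "transversal_lengths \<subseteq>
      (\<lambda>g. ext.transl_length (el g)) ` {g. set g \<subseteq> V \<times> UNIV \<and> length g \<le> card V}"
    by (auto simp: transversal_lengths_def raag_words_def)
  moreover have "finite {g. set g \<subseteq> V \<times> (UNIV :: bool set) \<and> length g \<le> card V}"
    using assms by (intro finite_lists_length_le) simp
  ultimately show ?thesis using finite_surj by blast
qed

lemma transversal_below:
  assumes "x \<in> carrier A" "ext.transl_length x > 0"
  shows "\<exists>t\<in>transversal_lengths. t \<le> ext.transl_length x"
proof -
  obtain h k where h: "h \<in> W" "k \<in> carrier A" "x = inv\<^bsub>A\<^esub> k \<otimes>\<^bsub>A\<^esub> el h \<otimes>\<^bsub>A\<^esub> k" "cyclically_reduced h"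
    using conj_cyclically_reduced[OF assms(1)] by blast
  have x: "ext.transl_length x = ext.transl_length (el h)"
    using h by (simp add: ext.transl_length_conj)
  obtain g where "subseq g h \<and> distinct (map fst g) \<and> fst ` set g = fst ` set h"
    using transversal_exists[of h] ..
  then have g: "subseq g h" "distinct (map fst g)" "fst ` set g = fst ` set h" by simp_all
  have gW: "g \<in> W" using words_subseq[OF g(1) h(1)] .
  have "spread (fst ` set g)"
    using spread_if_transl_length_pos[OF h(1)] assms(2) x g(3) by simp
  then have "ext.transl_length (el g) > 0" by (rule transl_length_pos[OF gW g(2)])
  then have "ext.transl_length (el g) \<in> transversal_lengths"
    by (rule transversal_lengthsI[OF gW g(2)])
  then show ?thesis using transl_length_subseq_le[OF h(1,4) g(1)] x by auto
qed

text \<open>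
  By \<open>transversal_below\<close> the minimum over a finite set is at the same time the least of all
  positive translation lengths.
\<close>

theorem min_transl_length_le:
  assumes "finite V" "g \<in> W" "distinct (map fst g)" "ext.transl_length (el g) > 0"
  shows "min_asymp_transl_length A (conj_act A) (ext_verts V E) (ext_dist V E) \<le> ext.transl_length (el g)"
proof -
  let ?m = "Min transversal_lengths"
  have g: "ext.transl_length (el g) \<in> transversal_lengths"
    by (rule transversal_lengthsI[OF assms(2-4)])
  have fin: "finite transversal_lengths" using assms finite_transversal_lengths by blast
  have "?m \<in> transversal_lengths" using g fin by (intro Min_in) auto
  then obtain f where f: "f \<in> W" "ext.transl_length (el f) > 0" "?m = ext.transl_length (el f)"
    unfolding transversal_lengths_def by auto
  have "min_asymp_transl_length A (conj_act A) (ext_verts V E) (ext_dist V E) = ?m"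
    unfolding min_asymp_transl_length_def transl_length_ext
  proof (rule Least_equality)
    show "?m \<in> {ext.transl_length x | x. x \<in> carrier A \<and> ext.transl_length x > 0}"
      using f by auto
    fix t assume "t \<in> {ext.transl_length x | x. x \<in> carrier A \<and> ext.transl_length x > 0}"
    then obtain t' where "t' \<in> transversal_lengths" "t' \<le> t"
      using transversal_below by blast
    then show "?m \<le> t" using Min_le[OF fin] by fastforce
  qed
  then show ?thesis using Min_le[OF fin g] by simp
qed

section \<open>An element of small translation length\<close>

lemma projections_commute:
  "(\<And>x y. x \<in> set u \<Longrightarrow> y \<in> set w \<Longrightarrow> (fst x, fst y) \<in> E) \<Longrightarrow>
    projections E (u @ w) = projections E (w @ u)"
proof (induction u)
  case (Cons x u)
  have "projections E (x # u @ w) = projections E (x # w @ u)"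
    using Cons by (intro projections_Cons_cong) simp
  also have "\<dots> = projections E (w @ x # u)"
    using Cons.prems projections_move[of x w u] by (simp add: commutes_past_def)
  finally show ?case by simp
qed simp

lemma sorted_filter_split:
  "sorted (map f xs) \<Longrightarrow> xs = filter (\<lambda>x. f x \<le> k) xs @ filter (\<lambda>x. \<not> f x \<le> k) xs"
proof (induction xs)
  case (Cons x xs)
  show ?case
  proof (cases "f x \<le> k")
    case False
    then have "\<not> f y \<le> k" if "y \<in> set (x # xs)" for y
      using that Cons.prems by fastforce
    then have "filter (\<lambda>x. f x \<le> k) (x # xs) = []" "filter (\<lambda>x. \<not> f x \<le> k) (x # xs) = x # xs"
      by (simp_all only: filter_empty_conv filter_id_conv) blast+
    then show ?thesis by simp
  qed (use Cons in simp)
qed simp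

text \<open>
  Induction on \<open>q\<close>: in \<open>g * g\<^sup>q = g X Y\<close> the part of \<open>g\<close> on levels above \<open>q + 1\<close> commutes with \<open>X\<close>,
  which lives on levels at most \<open>q\<close>, and moves into the second factor.
\<close>

lemma power_factorization:
  fixes l :: "'a \<Rightarrow> nat"
  assumes far: "\<And>u v. u \<in> V \<Longrightarrow> v \<in> V \<Longrightarrow> l u + 2 \<le> l v \<Longrightarrow> (u, v) \<in> E"
    and g: "g \<in> W" "sorted (map (l \<circ> fst) g)"
  shows "\<exists>X Y. X \<in> W \<and> Y \<in> W \<and> projections E (wpow g q) = projections E (X @ Y) \<and>
    (\<forall>x\<in>set X. l (fst x) \<le> q) \<and> (\<forall>y\<in>set Y. 2 \<le> l (fst y))"
proof (induction q)
  case 0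
  show ?case by (intro exI[of _ "[]"]) simp
next
  case (Suc q)
  then obtain X Y where XY: "X \<in> W" "Y \<in> W" "projections E (wpow g q) = projections E (X @ Y)"
    "\<forall>x\<in>set X. l (fst x) \<le> q" "\<forall>y\<in>set Y. 2 \<le> l (fst y)" by blast
  define lo where "lo = filter (\<lambda>x. l (fst x) \<le> Suc q) g"
  define hi where "hi = filter (\<lambda>x. \<not> l (fst x) \<le> Suc q) g"
  have split: "g = lo @ hi"
    using sorted_filter_split[OF g(2), of "Suc q"] by (simp add: lo_def hi_def)
  have W: "lo \<in> W" "hi \<in> W" using g(1) split by simp_all
  have "projections E (X @ hi) = projections E (hi @ X)"
  proof (rule projections_commute)
    fix x y assume xy: "x \<in> set X" "y \<in> set hi"
    then have "l (fst x) + 2 \<le> l (fst y)" using XY(4) by (fastforce simp: hi_def)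
    moreover have "fst x \<in> V" "fst y \<in> V" using xy XY(1) W(2) by (auto simp: words_iff)
    ultimately show "(fst x, fst y) \<in> E" using far by blast
  qed
  from projections_append_cong[OF HOL.refl projections_append_cong[OF this[symmetric] HOL.refl]]
  have "projections E (lo @ (hi @ X) @ Y) = projections E (lo @ (X @ hi) @ Y)" .
  moreover have "projections E (g @ wpow g q) = projections E (g @ X @ Y)"
    using XY(3) by (intro projections_append_cong) simp_all
  ultimately have "projections E (wpow g (Suc q)) = projections E ((lo @ X) @ (hi @ Y))"
    by (simp add: split)
  moreover have "\<forall>x\<in>set (lo @ X). l (fst x) \<le> Suc q" using XY(4) by (auto simp: lo_def)
  moreover have "\<forall>y\<in>set (hi @ Y). 2 \<le> l (fst y)" using XY(5) by (auto simp: hi_def)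
  ultimately show ?case using XY(1,2) W by (intro exI[of _ "lo @ X"] exI[of _ "hi @ Y"]) simp
qed

text \<open>
  The walk alternates between \<open>v\<close> and \<open>u\<close> and gains \<open>g\<^sup>q\<close> in every two steps.
\<close>

lemma transl_length_le_two_stars:
  assumes g: "g \<in> W" and uv: "(u, v) \<in> E" and q: "q > 0"
    and XY: "X \<in> raag_words (star u)" "Y \<in> raag_words (star v)" "el (wpow g q) = el (X @ Y)"
  shows "ext.transl_length (el g) \<le> 2 / real q"
proof -
  have V: "u \<in> V" "v \<in> V" using uv E_verts by auto
  have W: "X \<in> W" "Y \<in> W" using XY star_words by auto
  have walk: "\<exists>s. star_walk v (2 * k) v s \<and> el s = el (wpow g (k * q))" for k
  proof (induction k)
    case 0
    show ?case using V star_walk.start[of v "[]"] by auto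
  next
    case (Suc k)
    then obtain s where s: "star_walk v (2 * k) v s" "el s = el (wpow g (k * q))" by blast
    have sW: "s \<in> W" using star_walk_words[OF s(1)] by blast
    from star_walk.step[OF star_walk_extend[OF s(1) XY(2)] E_sym[OF uv] XY(1)]
    have "star_walk v (Suc (2 * k)) u (X @ Y @ s)" .
    from star_walk.step[OF this uv, of "[]"]
    have "star_walk v (2 * Suc k) v (X @ Y @ s)" by simp
    moreover have "el ((X @ Y) @ s) = el (wpow g q @ wpow g (k * q))"
      using W sW g XY(3) s(2) by (intro el_append_cong) simp_all
    ultimately show ?case by (intro exI[of _ "X @ Y @ s"]) (simp add: wpow_add)
  qed
  have "displacement v (wpow g (k * q)) \<le> 2 * k" for k
    using walk[of k] displacement_le displacement_cong by metis
  then have "real (displacement v (wpow g (k * q))) / real (k * q) \<le> 2 / real q" for k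
    using q of_nat_mono[of "displacement v (wpow g (k * q))" "2 * k", where 'a = real]
    by (cases "k = 0") (simp_all add: field_simps)
  moreover have "(\<lambda>k. real (displacement v (wpow g (k * q))) / real (k * q)) \<longlonglongrightarrow>
      ext.transl_length (el g)"
  proof -
    have "strict_mono (\<lambda>k. k * q)" using q by (simp add: strict_mono_def)
    from LIMSEQ_subseq_LIMSEQ[OF displacement_limit[OF V(2) g] this]
    show ?thesis by (simp add: comp_def)
  qed
  ultimately show ?thesis by (intro LIMSEQ_le_const2) blast+
qed

lemma spread_whole_graph:
  assumes "graph_connected V (complement_edges V E)" "u \<in> V" "u' \<in> V" "u \<noteq> u'"
  shows "spread V"
  unfolding spread_def
proof (intro conjI ballI assms(1))
  show "V \<noteq> {}" by (rule V_nonempty)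
  fix v assume v: "v \<in> V"
  obtain w where w: "w \<in> V" "w \<noteq> v" using assms by metis
  then have "(v, w) \<in> (complement_edges V E)\<^sup>*" using assms(1) v by (simp add: graph_connected_def)
  with w(2) obtain y where "(v, y) \<in> complement_edges V E" by (auto elim: converse_rtranclE)
  then have "y \<in> V" "y \<notin> star v" by (auto simp: complement_edges_def star_def)
  then show "\<not> V \<subseteq> star v" by blast
qed

end

theorem theoremB:
  fixes V :: "'a set" and E :: "('a \<times> 'a) set" and d :: nat
  assumes "finite V" and "simplicial_graph V E" and "biconnected V E"
    and "d = graph_diam V (complement_edges V E)"
    and "d \<ge> 3"
  shows "min_asymp_transl_length (raag V E) (conj_act (raag V E)) (ext_verts V E) (ext_dist V E)
    \<le> 2 / (real d - 2)"
proof -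
  let ?R = "complement_edges V E"
  let ?D = "{graph_dist ?R u v | u v. u \<in> V \<and> v \<in> V}"
  have conn: "graph_connected V ?R" and "graph_connected V E"
    using assms(3) by (auto simp: biconnected_def)
  have "?D = (\<lambda>(u, v). graph_dist ?R u v) ` (V \<times> V)" by auto
  then have fin: "finite ?D" using assms(1) by simp
  have "?D \<noteq> {}"
  proof
    assume "?D = {}"
    then have "d = 0" using assms(4) by (simp only: graph_diam_def Sup_nat_def) simp
    with assms(5) show False by simp
  qed
  then have "d \<in> ?D"
    using Max_in[OF fin] assms(4) by (simp add: graph_diam_def cSup_eq_Max[OF fin])
  then obtain v x where vx: "v \<in> V" "x \<in> V" "d = graph_dist ?R v x" by blast
  interpret connected_simplicial V E
    using assms(2) \<open>graph_connected V E\<close> vx(1) by unfold_locales auto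
  define l where "l = graph_dist ?R v"
  have lv: "l v = 0" unfolding l_def graph_dist_def by (rule Least_eq_0) simp
  have lstep: "l w \<le> Suc (l u)" if "(u, w) \<in> ?R" for u w
  proof -
    have "u \<in> V" using that by (simp add: complement_edges_def)
    then have "(v, u) \<in> ?R\<^sup>*" using conn vx(1) by (simp add: graph_connected_def)
    then have "(v, u) \<in> ?R ^^ l u"
      unfolding l_def graph_dist_def using rtrancl_imp_relpow by (metis LeastI)
    then have "(v, w) \<in> ?R ^^ Suc (l u)" using that by auto
    then show ?thesis unfolding l_def graph_dist_def by (rule Least_le)
  qed
  \<comment> \<open>An edge of the complement graph changes the level by at most one.\<close>
  have far: "(u, w) \<in> E" if "u \<in> V" "w \<in> V" "l u + 2 \<le> l w" for u w
    using that lstep[of u w] by (fastforce simp: complement_edges_def)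
  have lx: "l x = d" using vx(3) by (simp add: l_def)
  have vxE: "(v, x) \<in> E" using far vx(1,2) lv lx assms(5) by simp
  define vs where "vs = sort_key l (SOME vs. set vs = V \<and> distinct vs)"
  have "set (SOME vs. set vs = V \<and> distinct vs) = V \<and> distinct (SOME vs. set vs = V \<and> distinct vs)"
    by (rule someI_ex) (rule finite_distinct_list[OF assms(1)])
  then have vs: "set vs = V" "distinct vs" "sorted (map l vs)" by (simp_all add: vs_def)
  define g where "g = map (\<lambda>u. (u, True)) vs"
  have g: "g \<in> W" "distinct (map fst g)" "fst ` set g = V" "sorted (map (l \<circ> fst) g)"
    using vs by (simp_all add: g_def words_iff image_image comp_def)
  have "v \<noteq> x" using lv lx assms(5) by auto
  then have "spread (fst ` set g)" using spread_whole_graph[OF conn vx(1,2)] g(3) by simp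
  then have pos: "ext.transl_length (el g) > 0" by (rule transl_length_pos[OF g(1,2)])
  obtain X Y where XY: "X \<in> W" "Y \<in> W" "projections E (wpow g (d - 2)) = projections E (X @ Y)"
    "\<forall>z\<in>set X. l (fst z) \<le> d - 2" "\<forall>z\<in>set Y. 2 \<le> l (fst z)"
    using power_factorization[of l g "d - 2", OF far g(1,4)] by blast
  have "X \<in> raag_words (star x)"
    unfolding words_iff
  proof (intro subsetI)
    fix u assume "u \<in> fst ` set X"
    then have u: "u \<in> V" "l u \<le> d - 2" using XY(1,4) by (auto simp: words_iff)
    then have "(u, x) \<in> E" using far[of u x] vx(2) lx assms(5) by simp
    then show "u \<in> star x" using u(1) E_sym by (simp add: star_def)
  qed
  moreover have "Y \<in> raag_words (star v)"
    unfolding words_iff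
  proof (intro subsetI)
    fix u assume "u \<in> fst ` set Y"
    then have u: "u \<in> V" "2 \<le> l u" using XY(2,5) by (auto simp: words_iff)
    then show "u \<in> star v" using far[of v u] vx(1) lv by (simp add: star_def)
  qed
  moreover have "el (wpow g (d - 2)) = el (X @ Y)"
    using XY g(1) by (intro projections_imp_el) simp_all
  ultimately have "ext.transl_length (el g) \<le> 2 / real (d - 2)"
    using assms(5) by (intro transl_length_le_two_stars[OF g(1) E_sym[OF vxE]]) simp_all
  also have "real (d - 2) = real d - 2" using assms(5) by simp
  finally show ?thesis using min_transl_length_le[OF assms(1) g(1,2) pos] by simp
qed

end
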